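(* Let $\epsilon_0>0$, $c>0$, $t_0>0$ and $\eta(t)=\frac{c}{t+t_0}$. Let $\Omega(t)\subset\mathbb{R}^d$ ($d\in\{2,3\}$), $t\ge 0$, be a smoothly evolving domain with boundary $\Gamma(t)=\partial\Omega(t)$, whose motion is driven by a velocity field $\tilde{\bm w}$, with $\tilde{\bm w}(t)\in \mathbf{W}^{1,\infty}(\Omega(t))$ and sufficiently regular in space and time, satisfying the inertial $\mathbf{H}^1(\Omega(t))$ gradient flow: for every $t>0$ and every $\bm\chi\in\mathbf{H}^1(\Omega(t))$, $$\epsilon_0\int_{\Omega(t)}\Bigl[\partial_t^{\bullet}\tilde{\bm w}+\tfrac12\,\tilde{\bm w}\,(\nabla\cdot\tilde{\bm w})\Bigr]\cdot\bm\chi+\eta(t)\int_{\Omega(t)}\bigl(\tilde{\bm w}\cdot\bm\chi+\nabla\tilde{\bm w}:\nabla\bm\chi\bigr)=-\,\mathrm{d}J(\Gamma(t);\bm\chi).$$ Define the mechanical energy $$\mathcal{H}(t):=J(\Gamma(t))+\frac{\epsilon_0}{2}\,\|\tilde{\bm w}(t)\|_{\mathbf{L}^2(\Omega(t))}^2=\int_{\Omega(t)}\Bigl(j(x,u)+\tfrac{\epsilon_0}{2}|\tilde{\bm w}|^2\Bigr).$$ Then for all $t>0$, $$\frac{\mathrm{d}}{\mathrm{d}t}\mathcal{H}(t)=-\,\eta(t)\Bigl(\|\tilde{\bm w}\|_{\mathbf{L}^2(\Omega(t))}^2+\|\nabla\tilde{\bm w}\|_{\mathbf{L}^2(\Omega(t))}^2\Bigr)\le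 0.$$
   Context: Bold function spaces denote $\mathbb{R}^d$-valued functions, e.g. $\mathbf{H}^1(\Omega)=H^1(\Omega)^d$. Objective: $J(\Gamma)=\int_{\Omega}j(x,u)$ is a shape functional, where $\Gamma=\partial\Omega$ and $u=u(\Omega)$ is the solution of a given PDE constraint (state equation) posed on $\Omega$; for example, $-\Delta u+u=f$ in $\Omega$, $u=0$ on $\Gamma$, with $j(x,u)=\frac12|u-u_d|^2$. Domain evolution: that the motion of $\Omega(t)$ is driven by $\tilde{\bm w}$ means $\Omega(t)=\{\tilde\phi(p,t):p\in\Omega^0\}$ and $\Gamma(t)=\{\tilde\phi(p,t):p\in\Gamma^0\}$, where $\Gamma^0=\partial\Omega^0$ and the flow map $\tilde\phi$ satisfies $\partial_t\tilde\phi(p,t)=\tilde{\bm w}(\tilde\phi(p,t),t)$, $\tilde\phi(p,0)=p$. Material derivative: $\partial_t^{\bullet}f:=\partial_t f+\tilde{\bm w}\cdot\nabla f$ (componentwise for vector fields). Eulerian (shape) derivative: $\mathrm{d}J(\Gamma;\bm v)$ denotes the derivative of $J$ at $\Gamma$ in the direction of the velocity field $\bm v$, i.e. the derivative at $s=0$ of $J(\Gamma_s)$, where $\Gamma_s$ is the image of $\Gamma$ under the flow generated by a velocity field equal to $\bm v$ at $s=0$ (and $u$ is the state on the correspondingly transported domain). It is linear in $\bm v$ and assumed to be defined for the fields $\bm v\in\mathbf{H}^1(\Omega)$ used as test functions. In particular, along the evolution driven by $\tilde{\bm w}$, $\frac{\mathrm{d}}{\mathrm{d}t}J(\Gamma(t))=\mathrm{d}J(\Gamma(t);\tilde{\bm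 w}(t))$. All functions are assumed sufficiently regular for the Reynolds transport theorem $\frac{\mathrm{d}}{\mathrm{d}t}\int_{\Omega(t)}f=\int_{\Omega(t)}\bigl(\partial_t^{\bullet}f+f\,\nabla\cdot\tilde{\bm w}\bigr)$ to apply. *)

theory Defs
  imports "HOL-Analysis.Analysis"
begin

section \<open>Classical smoothness\<close>

text \<open>\<open>C_k_on k S f\<close> says that \<open>f\<close> is of class \<open>C\<close> to the \<open>k\<close> on \<open>S\<close>. The derivatives are two-sided,
  so this is meant for open \<open>S\<close>.\<close>

primrec C_k_on :: "nat \<Rightarrow> 'a::euclidean_space set \<Rightarrow> ('a \<Rightarrow> 'b::euclidean_space) \<Rightarrow> bool" where
  "C_k_on 0 S f \<longleftrightarrow> continuous_on S f"
| "C_k_on (Suc k) S f \<longleftrightarrow>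
     (\<forall>x\<in>S. f differentiable (at x)) \<and>
     (\<forall>b\<in>Basis. C_k_on k S (\<lambda>x. frechet_derivative f (at x) b))"

definition test_functions :: "'a::euclidean_space set \<Rightarrow> ('a \<Rightarrow> real) set" where
  "test_functions D =
     {\<psi>. (\<forall>k. C_k_on k UNIV \<psi>) \<and> (\<exists>K. compact K \<and> K \<subseteq> D \<and> (\<forall>x. x \<notin> K \<longrightarrow> \<psi> x = 0))}"


section \<open>Lebesgue and Sobolev spaces on an open set\<close>

text \<open>Elements of these spaces are functions on the whole space of which only the values on \<open>D\<close>
  matter; functions that agree almost everywhere are not identified.\<close>

definition L2 :: "'a::euclidean_space set \<Rightarrow> ('a \<Rightarrow> 'b::euclidean_space) set" where
  "L2 D = {f. f \<in> borel_measurable (lebesgue_on D) \<and>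
              (\<lambda>x. (norm (f x))\<^sup>2) absolutely_integrable_on D}"

definition L2_norm :: "'a::euclidean_space set \<Rightarrow> ('a \<Rightarrow> 'b::euclidean_space) \<Rightarrow> real" where
  "L2_norm D f = sqrt (LINT x:D|lebesgue. (norm (f x))\<^sup>2)"

definition Linf :: "'a::euclidean_space set \<Rightarrow> ('a \<Rightarrow> 'b::euclidean_space) set" where
  "Linf D = {f. f \<in> borel_measurable (lebesgue_on D) \<and>
                (\<exists>C. AE x in lebesgue_on D. norm (f x) \<le> C)}"

text \<open>\<open>G\<close> is a weak (distributional) Jacobian of the vector field \<open>v\<close>: the entry \<open>G x $ i $ j\<close> is the
  weak \<open>j\<close>-th partial derivative of the \<open>i\<close>-th component. The inner product \<open>A \<bullet> B\<close> and the norm on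
  \<open>real^'n^'n\<close> are the Frobenius ones.\<close>

definition has_weak_jacobian ::
    "(real^'n) set \<Rightarrow> (real^'n \<Rightarrow> real^'n) \<Rightarrow> (real^'n \<Rightarrow> real^'n^'n) \<Rightarrow> bool" where
  "has_weak_jacobian D v G \<longleftrightarrow>
     (\<forall>K. compact K \<and> K \<subseteq> D \<longrightarrow> v absolutely_integrable_on K \<and> G absolutely_integrable_on K) \<and>
     (\<forall>\<psi>\<in>test_functions D. \<forall>i j.
        (LINT x:D|lebesgue. v x $ i * frechet_derivative \<psi> (at x) (axis j 1)) =
        - (LINT x:D|lebesgue. G x $ i $ j * \<psi> x))"

definition H1 :: "(real^'n) set \<Rightarrow> (real^'n \<Rightarrow> real^'n) set" where
  "H1 D = {v. v \<in> L2 D \<and> (\<exists>G. has_weak_jacobian D v G \<and> G \<in> L2 D)}"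

definition W1inf :: "(real^'n) set \<Rightarrow> (real^'n \<Rightarrow> real^'n) set" where
  "W1inf D = {v. v \<in> Linf D \<and> (\<exists>G. has_weak_jacobian D v G \<and> G \<in> Linf D)}"


section \<open>Moving domains\<close>

definition divergence :: "(real^'n \<Rightarrow> real^'n) \<Rightarrow> real^'n \<Rightarrow> real" where
  "divergence v x = trace (jacobian v (at x))"

definition material_derivative ::
    "(real \<Rightarrow> real^'n \<Rightarrow> real^'n) \<Rightarrow> (real \<Rightarrow> real^'n \<Rightarrow> 'b::real_normed_vector)
     \<Rightarrow> real \<Rightarrow> real^'n \<Rightarrow> 'b" where
  "material_derivative w f t x =
     vector_derivative (\<lambda>s. f s x) (at t) + frechet_derivative (f t) (at x) (w t x)"

text \<open>The motion of the domains \<open>\<Omega> t\<close>, for \<open>t\<close> in the time interval \<open>I\<close> (with \<open>0 \<in> I\<close>), is driven by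
  the velocity field \<open>w\<close> with flow map \<open>\<phi>\<close>. The boundary is carried along by the flow.\<close>

definition driven_by ::
    "real set \<Rightarrow> (real \<Rightarrow> (real^'n) set) \<Rightarrow> (real \<Rightarrow> real^'n \<Rightarrow> real^'n)
     \<Rightarrow> (real \<Rightarrow> real^'n \<Rightarrow> real^'n) \<Rightarrow> bool" where
  "driven_by I \<Omega> w \<phi> \<longleftrightarrow>
     open (\<Omega> 0) \<and> connected (\<Omega> 0) \<and> \<Omega> 0 \<noteq> {} \<and>
     (\<forall>p\<in>closure (\<Omega> 0). \<phi> 0 p = p) \<and>
     (\<forall>t\<in>I. \<forall>p\<in>closure (\<Omega> 0).
        ((\<lambda>s. \<phi> s p) has_vector_derivative w t (\<phi> t p)) (at t within I)) \<and>
     (\<forall>t\<in>I. \<Omega> t = \<phi> t ` \<Omega> 0 \<and> frontier (\<Omega> t) = \<phi> t ` frontier (\<Omega> 0) \<and>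
        (\<exists>g. homeomorphism (closure (\<Omega> 0)) (closure (\<Omega> t)) (\<phi> t) g))"

text \<open>Regularity of the velocity in space and time, of the kind needed for the transport theorem:
  it is continuous up to the moving boundary, lies in \<open>W1inf\<close> at each time, and is of class \<open>C\<close> to
  the 1 in the moving open domain, where it, its gradient and its material derivative satisfy
  locally uniform bounds in time along trajectories. The square integrable majorant \<open>g\<close> makes the
  energy and its rate meaningful on unbounded domains as well; when \<open>\<Omega> 0\<close> is bounded and the
  derivatives are bounded locally uniformly in time, a constant \<open>g\<close> does.\<close>

definition regular_velocity ::
    "real set \<Rightarrow> (real \<Rightarrow> (real^'n) set) \<Rightarrow> (real \<Rightarrow> real^'n \<Rightarrow> real^'n)
     \<Rightarrow> (real \<Rightarrow> real^'n \<Rightarrow> real^'n) \<Rightarrow> bool" where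
  "regular_velocity I \<Omega> w \<phi> \<longleftrightarrow>
     C_k_on 1 {(t, x). t \<in> interior I \<and> x \<in> \<Omega> t} (\<lambda>(t, x). w t x) \<and>
     continuous_on {(t, x). t \<in> I \<and> x \<in> closure (\<Omega> t)} (\<lambda>(t, x). w t x) \<and>
     (\<forall>t\<in>I. w t \<in> W1inf (\<Omega> t)) \<and>
     (\<forall>t\<in>interior I. \<exists>\<delta>>0. \<exists>M. \<exists>g::real^'n \<Rightarrow> real. g \<in> L2 (\<Omega> t) \<and>
        (\<forall>s\<in>interior I. \<bar>s - t\<bar> < \<delta> \<longrightarrow> (\<forall>p\<in>\<Omega> 0.
           norm (w s (\<phi> s p)) \<le> min M (g (\<phi> t p)) \<and>
           norm (jacobian (w s) (at (\<phi> s p))) \<le> min M (g (\<phi> t p)) \<and>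
           norm (material_derivative w w s (\<phi> s p)) \<le> g (\<phi> t p))))"


section \<open>The shape functional and its Eulerian derivative\<close>

text \<open>The state equation is an arbitrary relation between a domain and a function on it;
  \<open>u D\<close> is its solution on \<open>D\<close> (unique up to null sets) whenever there is one. Values of the state
  are vectors in general.\<close>

definition solution_map ::
    "('a::euclidean_space set \<Rightarrow> ('a \<Rightarrow> 'b) \<Rightarrow> bool) \<Rightarrow> ('a set \<Rightarrow> 'a \<Rightarrow> 'b) \<Rightarrow> bool" where
  "solution_map PDE u \<longleftrightarrow>
     (\<forall>D v. PDE D v \<longrightarrow> PDE D (u D) \<and> (AE x in lebesgue. x \<in> D \<longrightarrow> v x = u D x))"

definition shape_functional ::
    "('a::euclidean_space \<Rightarrow> 'b \<Rightarrow> real) \<Rightarrow> ('a set \<Rightarrow> 'a \<Rightarrow> 'b) \<Rightarrow> 'a set \<Rightarrow> real" where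
  "shape_functional j u D = (LINT x:D|lebesgue. j x (u D x))"

text \<open>\<open>L\<close> is the Eulerian derivative of \<open>J\<close> at \<open>D\<close>: a linear functional on \<open>H1 D\<close> whose value at \<open>v\<close> is
  the rate of change at time 0 of \<open>J\<close> along every regular motion of domains that starts from \<open>D\<close>
  with initial velocity \<open>v\<close>. On fields in \<open>H1 D\<close> that do not generate such a motion, only linearity
  is required.\<close>

definition has_eulerian_derivative ::
    "((real^'n) set \<Rightarrow> real) \<Rightarrow> (real^'n) set \<Rightarrow> ((real^'n \<Rightarrow> real^'n) \<Rightarrow> real) \<Rightarrow> bool" where
  "has_eulerian_derivative J D L \<longleftrightarrow>
     (\<forall>v\<in>H1 D. \<forall>v'\<in>H1 D. \<forall>a b. L (\<lambda>x. a *\<^sub>R v x + b *\<^sub>R v' x) = a * L v + b * L v') \<and>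
     (\<forall>v\<in>H1 D. \<forall>\<delta>>0. \<forall>E V \<Phi>.
        E 0 = D \<and> driven_by {-\<delta><..<\<delta>} E V \<Phi> \<and> regular_velocity {-\<delta><..<\<delta>} E V \<Phi> \<and>
        (\<forall>x\<in>D. V 0 x = v x)
        \<longrightarrow> ((\<lambda>s. J (E s)) has_real_derivative L v) (at 0))"


section \<open>The inertial gradient flow\<close>

text \<open>The gradient of \<open>w t\<close> is the classical one. The weak gradient of the test field \<open>\<xi>\<close> is determined
  up to null sets, so quantifying over all its representatives \<open>G\<close> is no restriction.\<close>

definition inertial_gradient_flow ::
    "real \<Rightarrow> (real \<Rightarrow> real) \<Rightarrow> ((real^'n) set \<Rightarrow> (real^'n \<Rightarrow> real^'n) \<Rightarrow> real)
     \<Rightarrow> (real \<Rightarrow> (real^'n) set) \<Rightarrow> (real \<Rightarrow> real^'n \<Rightarrow> real^'n) \<Rightarrow> bool" where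
  "inertial_gradient_flow \<epsilon>0 \<eta> dJ \<Omega> w \<longleftrightarrow>
     (\<forall>t>0. \<forall>\<xi>\<in>H1 (\<Omega> t). \<forall>G. has_weak_jacobian (\<Omega> t) \<xi> G \<longrightarrow>
        \<epsilon>0 * (LINT x:\<Omega> t|lebesgue.
               (material_derivative w w t x + (1/2) *\<^sub>R (divergence (w t) x *\<^sub>R w t x)) \<bullet> \<xi> x)
        + \<eta> t * (LINT x:\<Omega> t|lebesgue. w t x \<bullet> \<xi> x + jacobian (w t) (at x) \<bullet> G x)
        = - dJ (\<Omega> t) \<xi>)"

definition mechanical_energy ::
    "real \<Rightarrow> ((real^'n) set \<Rightarrow> real) \<Rightarrow> (real \<Rightarrow> (real^'n) set) \<Rightarrow> (real \<Rightarrow> real^'n \<Rightarrow> real^'n)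
     \<Rightarrow> real \<Rightarrow> real" where
  "mechanical_energy \<epsilon>0 J \<Omega> w t = J (\<Omega> t) + \<epsilon>0 / 2 * (L2_norm (\<Omega> t) (w t))\<^sup>2"

end

theory Submission
  imports Defs
begin

text \<open>
  The energy identity is the flow equation tested with its own velocity. Taking \<open>w t\<close> as the test
  field, with its classical gradient as weak gradient, gives
  \<open>dJ(w) + \<epsilon>0 \<integral> (Dw + 1/2 w div w) \<bullet> w = - \<eta> (\<integral> |w|\<^sup>2 + \<integral> |\<nabla>w|\<^sup>2)\<close>, where \<open>D\<close> is the material
  derivative. It remains to recognise the left-hand side as the rate of change of the energy.
  This takes three facts.

  \<^item> The velocity is an admissible test field. On the open set \<open>\<Omega> t\<close> the field \<open>w t\<close> is of class \<open>C\<close>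
    to the 1 with \<open>w t\<close> and its Jacobian dominated by a square integrable function, and integration by
    parts against test functions identifies the classical Jacobian with the weak one
    (\<open>classical_imp_weak_jacobian\<close>, \<open>velocity_H1\<close>).

  \<^item> \<open>dJ(w)\<close> is the time derivative of \<open>J (\<Omega> t)\<close>: the motion restarted at time \<open>t\<close> is one of the
    motions that start at \<open>\<Omega> t\<close> with velocity \<open>w t\<close>, for which the Eulerian derivative gives the rate
    of change of the functional (\<open>restarted_motion\<close>, \<open>shape_functional_derivative\<close>).

  \<^item> \<open>2 \<integral> (Dw + 1/2 w div w) \<bullet> w = \<integral> (D|w|\<^sup>2 + |w|\<^sup>2 div w)\<close> is the time derivative of \<open>\<integral> |w|\<^sup>2\<close> by the
    Reynolds transport theorem (\<open>reynolds_transport\<close>, \<open>kinetic_energy_derivative\<close>). The factor 1/2 in the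
    equation is exactly what makes this work.

  The transport theorem is proved by pulling the integral back to the initial domain with the flow.
  Exchanging the order of the derivatives in time and space shows that the spatial derivative of the flow
  solves the linear equation \<open>A' = \<nabla>w A\<close>. Jacobi's formula then gives \<open>(det A)' = (div w) det A\<close>,
  and the same equation for \<open>|det A|\<close>, because a solution of a scalar linear equation never changes
  sign. Gronwall's inequality compares the volume factors at nearby times, which yields the integrable
  majorant required to differentiate under the integral sign.
\<close>

section \<open>Continuously differentiable functions\<close>

lemma C1_onD:
  assumes "C_k_on 1 S f" "x \<in> S"
  shows "(f has_derivative frechet_derivative f (at x)) (at x)"
  using assms by (simp add: frechet_derivative_works)

text \<open>Continuity of the derivative is given for the basis directions only; linearity extends it to
  directions that vary continuously with the point.\<close>

lemma C1_on_continuous_derivative: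
  fixes f :: "'a::euclidean_space \<Rightarrow> 'b::euclidean_space"
  assumes C1: "C_k_on 1 S f" and h: "continuous_on S h"
  shows "continuous_on S (\<lambda>x. frechet_derivative f (at x) (h x))"
proof -
  have "continuous_on S (\<lambda>x. \<Sum>b\<in>Basis. (h x \<bullet> b) *\<^sub>R frechet_derivative f (at x) b)"
    using C1 by (intro continuous_intros h) auto
  moreover have "frechet_derivative f (at x) (h x)
      = (\<Sum>b\<in>Basis. (h x \<bullet> b) *\<^sub>R frechet_derivative f (at x) b)" if "x \<in> S" for x
  proof -
    have "linear (frechet_derivative f (at x))"
      using C1_onD[OF C1 that] by (rule has_derivative_linear)
    then have "frechet_derivative f (at x) (\<Sum>b\<in>Basis. (h x \<bullet> b) *\<^sub>R b)
        = (\<Sum>b\<in>Basis. (h x \<bullet> b) *\<^sub>R frechet_derivative f (at x) b)"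
      by (simp add: linear_sum linear_scale)
    then show ?thesis
      by (simp add: euclidean_representation)
  qed
  ultimately show ?thesis
    by (simp cong: continuous_on_cong)
qed

lemma C1_on_continuous: "continuous_on S f" if "C_k_on 1 S f"
  using that by (auto intro!: differentiable_imp_continuous_on
      simp: differentiable_on_def differentiable_at_withinI)

lemma C2_imp_C1: "C_k_on 2 S f \<Longrightarrow> C_k_on 1 S f"
  by (auto simp: numeral_2_eq_2 differentiable_on_def differentiable_at_withinI
      intro!: differentiable_imp_continuous_on)

text \<open>Translation in space-time carries the regularity of the velocity over to a motion that is restarted
  at a later time.\<close>

lemma C1_on_translate:
  assumes f: "C_k_on 1 S f" and T: "\<And>z. z \<in> T \<Longrightarrow> c + z \<in> S"
  shows "C_k_on 1 T (\<lambda>z. f (c + z))"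
proof -
  have deriv: "((\<lambda>z. f (c + z)) has_derivative frechet_derivative f (at (c + z))) (at z)" if "z \<in> T" for z
  proof -
    have "((\<lambda>z. c + z) has_derivative (\<lambda>h. h)) (at z)"
      by (auto intro!: derivative_eq_intros)
    from diff_chain_at[OF this C1_onD[OF f T[OF that]]] show ?thesis
      by (simp add: o_def)
  qed
  have "continuous_on T (\<lambda>z. frechet_derivative (\<lambda>z. f (c + z)) (at z) b)" for b
  proof -
    have "continuous_on T (\<lambda>z. frechet_derivative f (at (c + z)) b)"
      using T by (intro continuous_on_compose2[OF C1_on_continuous_derivative[OF f continuous_on_const]]
          continuous_intros) auto
    then show ?thesis
      by (rule continuous_on_eq) (metis deriv frechet_derivative_at)
  qed
  with deriv show ?thesis
    by (auto simp: differentiable_def)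
qed

lemma has_vector_derivative_shift:
  assumes "(f has_vector_derivative d) (at (t + s))"
  shows "((\<lambda>r. f (t + r)) has_vector_derivative d) (at (s::real))"
proof -
  have "((\<lambda>r. t + r) has_vector_derivative 1) (at s)"
    by (auto intro!: derivative_eq_intros)
  from vector_diff_chain_at[OF this assms] show ?thesis
    by (simp add: o_def)
qed

section \<open>Determinants along linear differential equations\<close>

text \<open>Jacobi's formula in row form: the Leibniz expansion of the determinant is a sum of products with
  one factor from each row, so the product rule differentiates one row at a time.\<close>

lemma has_field_derivative_det:
  fixes A :: "real \<Rightarrow> real^'n^'n" and A' :: "real^'n^'n"
  assumes "\<And>i j. ((\<lambda>s. A s $ i $ j) has_real_derivative A' $ i $ j) (at t)"
  shows "((\<lambda>s. det (A s)) has_real_derivative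
           (\<Sum>k\<in>UNIV. det (\<chi> i. if i = k then A' $ k else A t $ i))) (at t)"
proof -
  let ?P = "{p. p permutes (UNIV::'n set)}"
  have prod: "(\<Prod>i\<in>UNIV. (\<chi> i. if i = k then A' $ k else A t $ i) $ i $ p i)
      = A' $ k $ p k * (\<Prod>i\<in>UNIV - {k}. A t $ i $ p i)" for p and k :: 'n
    by (subst prod.remove[of UNIV k]) (auto intro!: prod.cong)
  have "((\<lambda>s. det (A s)) has_real_derivative
      (\<Sum>p\<in>?P. of_int (sign p) * (\<Sum>k\<in>UNIV. A' $ k $ p k * (\<Prod>i\<in>UNIV - {k}. A t $ i $ p i)))) (at t)"
    unfolding det_def
    by (auto intro!: derivative_eq_intros assms sum.cong has_field_derivative_prod simp: field_simps)
  also have "(\<Sum>p\<in>?P. of_int (sign p) * (\<Sum>k\<in>UNIV. A' $ k $ p k * (\<Prod>i\<in>UNIV - {k}. A t $ i $ p i)))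
      = (\<Sum>k\<in>UNIV. det (\<chi> i. if i = k then A' $ k else A t $ i))"
    unfolding det_def prod sum_distrib_left by (rule sum.swap)
  finally show ?thesis .
qed

text \<open>Liouville's formula. Row \<open>k\<close> of \<open>W ** A\<close> is a combination of the rows of \<open>A\<close>; when it replaces row
  \<open>k\<close> of \<open>A\<close>, every contribution but that of row \<open>k\<close> itself produces two equal rows and disappears.\<close>

lemma has_field_derivative_det_linear_ode:
  fixes A :: "real \<Rightarrow> real^'n^'n" and W :: "real^'n^'n"
  assumes "\<And>i j. ((\<lambda>s. A s $ i $ j) has_real_derivative (W ** A t) $ i $ j) (at t)"
  shows "((\<lambda>s. det (A s)) has_real_derivative trace W * det (A t)) (at t)"
proof -
  have "det (\<chi> i. if i = k then (W ** A t) $ k else A t $ i) = W $ k $ k * det (A t)" for k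
  proof -
    have row: "(W ** A t) $ k = (\<Sum>l\<in>UNIV. W $ k $ l *s A t $ l)"
      by (simp add: matrix_mul_sum_alt)
    have summand: "det (\<chi> i. if i = k then W $ k $ l *s A t $ l else A t $ i)
        = (if l = k then W $ k $ k * det (A t) else 0)" for l
    proof (cases "l = k")
      case True
      have "(\<chi> i. if i = k then A t $ k else A t $ i) = A t"
        by (simp add: vec_eq_iff)
      with True show ?thesis
        using det_row_mul[of k "W $ k $ k" "\<lambda>i. A t $ k" "\<lambda>i. A t $ i"]
        by (simp cong: if_cong)
    next
      case False
      have "det (\<chi> i. if i = k then A t $ l else A t $ i) = 0"
        using False by (intro det_identical_rows[of k l]) (auto simp: row_def vec_eq_iff)
      with False show ?thesis
        using det_row_mul[of k "W $ k $ l" "\<lambda>i. A t $ l" "\<lambda>i. A t $ i"] by simp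
    qed
    show ?thesis
      unfolding row by (simp add: det_linear_row_sum summand)
  qed
  then show ?thesis
    using has_field_derivative_det[OF assms] by (simp add: trace_def sum_distrib_right)
qed

text \<open>The solution is a constant multiple of an exponential, so its absolute value is a multiple of the
  same exponential. This also covers the solution 0, so that \<open>y\<close> may vanish although the absolute value is
  not differentiable at 0.\<close>

lemma abs_linear_ode:
  fixes y a :: "real \<Rightarrow> real"
  assumes t: "t > 0"
    and y: "\<And>s. s > 0 \<Longrightarrow> (y has_real_derivative a s * y s) (at s)"
    and a: "continuous_on {0<..} a"
  shows "((\<lambda>s. \<bar>y s\<bar>) has_real_derivative a t * \<bar>y t\<bar>) (at t)"
proof -
  define \<alpha> where "\<alpha> = t / 2"
  have \<alpha>: "0 < \<alpha>" "\<alpha> < t" using t by (auto simp: \<alpha>_def)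
  define b where "b s = integral {\<alpha>..s} a" for s
  have b: "(b has_real_derivative a s) (at s)" if s: "s > \<alpha>" for s
  proof -
    have "continuous_on {\<alpha>..s + 1} a"
      using \<alpha> by (intro continuous_on_subset[OF a]) auto
    then have "(b has_real_derivative a s) (at s within {\<alpha>..s+1})"
      unfolding b_def using s by (intro integral_has_real_derivative) auto
    moreover have "at s within {\<alpha>..s+1} = at s"
      using s by (intro at_within_interior) auto
    ultimately show ?thesis by simp
  qed
  have "\<exists>c. \<forall>s\<in>{\<alpha><..}. y s * exp (- b s) = c"
  proof (rule has_field_derivative_zero_constant)
    fix s assume "s \<in> {\<alpha><..}"
    then have s: "s > \<alpha>" "s > 0" using \<alpha> by auto
    have "((\<lambda>s. y s * exp (- b s)) has_real_derivative 0) (at s)"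
      using y[OF s(2)] b[OF s(1)] by (auto intro!: derivative_eq_intros simp: algebra_simps)
    then show "((\<lambda>s. y s * exp (- b s)) has_real_derivative 0) (at s within {\<alpha><..})"
      by (rule has_field_derivative_at_within)
  qed auto
  then obtain c where c: "\<And>s. s > \<alpha> \<Longrightarrow> y s * exp (- b s) = c"
    by auto
  have eq: "\<bar>y s\<bar> = \<bar>c\<bar> * exp (b s)" if "s \<in> {\<alpha><..}" for s
    using c[of s] that by (auto simp: exp_minus field_simps abs_mult)
  have "((\<lambda>s. \<bar>c\<bar> * exp (b s)) has_real_derivative a t * \<bar>y t\<bar>) (at t)"
    using b[OF \<alpha>(2)] \<alpha> by (auto intro!: derivative_eq_intros simp: eq)
  then show ?thesis
    by (rule has_field_derivative_transform_within_open[where S = "{\<alpha><..}"]) (use \<alpha> eq in auto)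
qed

text \<open>Gronwall's inequality, forwards and backwards in time.\<close>

lemma linear_ode_growth_bound:
  fixes z a :: "real \<Rightarrow> real"
  assumes z: "\<And>s. \<bar>s - t\<bar> < \<delta> \<Longrightarrow> (z has_real_derivative a s * z s) (at s)"
    and nonneg: "\<And>s. z s \<ge> 0"
    and a: "\<And>s. \<bar>s - t\<bar> < \<delta> \<Longrightarrow> \<bar>a s\<bar> \<le> K"
    and s: "\<bar>s - t\<bar> < \<delta>"
  shows "z s \<le> z t * exp (K * \<bar>s - t\<bar>)"
proof (cases "t \<le> s")
  case True
  have "z s * exp (- K * s) \<le> z t * exp (- K * t)"
  proof (rule DERIV_nonpos_imp_nonincreasing[OF True])
    fix r assume "t \<le> r" "r \<le> s"
    then have r: "\<bar>r - t\<bar> < \<delta>" using s by auto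
    have "((\<lambda>s. z s * exp (- K * s)) has_real_derivative (a r - K) * z r * exp (- K * r)) (at r)"
      using z[OF r] by (auto intro!: derivative_eq_intros simp: algebra_simps)
    moreover have "(a r - K) * z r * exp (- K * r) \<le> 0"
      using a[OF r] nonneg[of r] by (auto intro!: mult_nonpos_nonneg)
    ultimately show "\<exists>y. ((\<lambda>s. z s * exp (- K * s)) has_real_derivative y) (at r) \<and> y \<le> 0"
      by blast
  qed
  then show ?thesis
    using True by (simp add: exp_minus exp_diff field_simps)
next
  case False
  then have "s \<le> t" by simp
  have "z s * exp (K * s) \<le> z t * exp (K * t)"
  proof (rule DERIV_nonneg_imp_nondecreasing[OF \<open>s \<le> t\<close>])
    fix r assume "s \<le> r" "r \<le> t"
    then have r: "\<bar>r - t\<bar> < \<delta>" using s by auto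
    have "((\<lambda>s. z s * exp (K * s)) has_real_derivative (a r + K) * z r * exp (K * r)) (at r)"
      using z[OF r] by (auto intro!: derivative_eq_intros simp: algebra_simps)
    moreover have "(a r + K) * z r * exp (K * r) \<ge> 0"
      using a[OF r] nonneg[of r] by (auto intro!: mult_nonneg_nonneg)
    ultimately show "\<exists>y. ((\<lambda>s. z s * exp (K * s)) has_real_derivative y) (at r) \<and> 0 \<le> y"
      by blast
  qed
  then show ?thesis
    using False by (simp add: exp_diff field_simps)
qed

lemma trace_continuous [continuous_intros]:
  assumes "\<And>i. continuous_on S (\<lambda>x. f x $ i $ i :: real)"
  shows "continuous_on S (\<lambda>x. trace (f x))"
  unfolding trace_def by (intro continuous_on_sum assms)

lemma trace_le_norm: "\<bar>trace A\<bar> \<le> CARD('n) * norm A" for A :: "real^'n^'n"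
proof -
  have "\<bar>A $ i $ i\<bar> \<le> norm A" for i
    using component_le_norm_cart[of "A $ i" i] Finite_Cartesian_Product.norm_nth_le[of A i] by linarith
  then have "(\<Sum>i\<in>UNIV. \<bar>A $ i $ i\<bar>) \<le> (\<Sum>i\<in>(UNIV::'n set). norm A)"
    by (intro sum_mono)
  then show ?thesis
    unfolding trace_def using order_trans[OF sum_abs] by force
qed

section \<open>The spatial derivative of a flow\<close>

text \<open>The derivatives in time and space of a flow commute. The equation is first integrated in time,
  \<open>\<phi> s q = \<phi> \<alpha> q + \<integral> a\<close>, then differentiated under the integral sign along the line through \<open>p\<close> in
  direction \<open>h\<close>, and finally differentiated in time.\<close>

lemma flow_derivative_ode:
  fixes \<phi> a :: "real \<Rightarrow> 'a::euclidean_space \<Rightarrow> 'b::euclidean_space"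
  assumes U: "open U" "p \<in> U" and t: "t > 0"
    and ode: "\<And>s q. s > 0 \<Longrightarrow> q \<in> U \<Longrightarrow> ((\<lambda>s. \<phi> s q) has_vector_derivative a s q) (at s)"
    and D\<phi>: "\<And>s q. s > 0 \<Longrightarrow> q \<in> U \<Longrightarrow> (\<phi> s has_derivative D\<phi> s q) (at q)"
    and Da: "\<And>s q. s > 0 \<Longrightarrow> q \<in> U \<Longrightarrow> (a s has_derivative Da s q) (at q)"
    and cont: "continuous_on ({0<..} \<times> U) (\<lambda>(s, q). Da s q h)"
  shows "((\<lambda>s. D\<phi> s p h) has_vector_derivative Da t p h) (at t)"
proof -
  \<comment> \<open>The regularity holds at positive times only, so the integration in time starts at a positive \<open>\<alpha>\<close>.\<close>
  define \<alpha> where "\<alpha> = t / 2"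
  have \<alpha>: "0 < \<alpha>" "\<alpha> < t" using t by (auto simp: \<alpha>_def)
  \<comment> \<open>Near \<open>p\<close> the line stays inside the open set, which reduces the claim to one space variable.\<close>
  let ?T = "(\<lambda>\<tau>. p + \<tau> *\<^sub>R h) -` U"
  have "open ?T"
    by (intro open_vimage U(1) continuous_intros)
  moreover have "0 \<in> ?T" using U by simp
  ultimately obtain r where r: "r > 0" "ball 0 r \<subseteq> ?T"
    by (meson open_contains_ball)
  have in_U: "p + \<tau> *\<^sub>R h \<in> U" if "\<tau> \<in> ball 0 r" for \<tau>
    using r that by auto
  have line: "((\<lambda>\<tau>. p + \<tau> *\<^sub>R h) has_derivative (\<lambda>\<tau>. \<tau> *\<^sub>R h)) (at \<tau>)" for \<tau>
    by (auto intro!: derivative_eq_intros)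
  have along: "((\<lambda>\<tau>. f (p + \<tau> *\<^sub>R h)) has_vector_derivative f' h) (at \<tau> within ball 0 r)"
    if "(f has_derivative f') (at (p + \<tau> *\<^sub>R h))" for f :: "'a \<Rightarrow> 'b" and f' \<tau>
  proof -
    have "((\<lambda>\<tau>. f (p + \<tau> *\<^sub>R h)) has_derivative (\<lambda>k. f' (k *\<^sub>R h))) (at \<tau>)"
      using diff_chain_at[OF line that] by (simp add: o_def)
    then show ?thesis
      unfolding has_vector_derivative_def
      using has_derivative_linear[OF that] by (simp add: linear_scale has_derivative_at_withinI)
  qed
  have increment: "D\<phi> s p h - D\<phi> \<alpha> p h = integral {\<alpha>..s} (\<lambda>r. Da r p h)" if s: "\<alpha> \<le> s" for s
  proof -
    have ftc: "((\<lambda>r. a r q) has_integral \<phi> s q - \<phi> \<alpha> q) {\<alpha>..s}" if "q \<in> U" for q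
      using \<alpha> s that by (intro fundamental_theorem_of_calculus)
        (auto intro: has_vector_derivative_at_within[OF ode])
    have "((\<lambda>\<tau>. integral (cbox \<alpha> s) (\<lambda>r. a r (p + \<tau> *\<^sub>R h))) has_vector_derivative
        integral (cbox \<alpha> s) (\<lambda>r. Da r (p + 0 *\<^sub>R h) h)) (at 0 within ball 0 r)"
    proof (rule leibniz_rule_vector_derivative)
      show "((\<lambda>\<tau>. a r' (p + \<tau> *\<^sub>R h)) has_vector_derivative Da r' (p + \<tau> *\<^sub>R h) h) (at \<tau> within ball 0 r)"
        if "\<tau> \<in> ball 0 r" "r' \<in> cbox \<alpha> s" for \<tau> r'
        by (rule along[OF Da[OF _ in_U]]) (use that \<alpha> in auto)
      show "(\<lambda>r. a r (p + \<tau> *\<^sub>R h)) integrable_on cbox \<alpha> s" if "\<tau> \<in> ball 0 r" for \<tau>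
        using ftc[OF in_U[OF that]] by (auto simp: has_integral_integrable)
      have "continuous_on (ball 0 r \<times> cbox \<alpha> s) (\<lambda>z. (\<lambda>(s, q). Da s q h) (snd z, p + fst z *\<^sub>R h))"
        using \<alpha> in_U by (intro continuous_on_compose2[OF cont] continuous_intros) auto
      then show "continuous_on (ball 0 r \<times> cbox \<alpha> s) (\<lambda>(\<tau>, r). Da r (p + \<tau> *\<^sub>R h) h)"
        by (simp add: case_prod_beta)
    qed (use r in auto)
    moreover have "((\<lambda>\<tau>. integral (cbox \<alpha> s) (\<lambda>r. a r (p + \<tau> *\<^sub>R h))) has_vector_derivative
        D\<phi> s p h - D\<phi> \<alpha> p h) (at 0 within ball 0 r)"
    proof (rule has_vector_derivative_transform)
      show "((\<lambda>\<tau>. \<phi> s (p + \<tau> *\<^sub>R h) - \<phi> \<alpha> (p + \<tau> *\<^sub>R h)) has_vector_derivative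
          D\<phi> s p h - D\<phi> \<alpha> p h) (at 0 within ball 0 r)"
        using along[of "\<phi> s" "D\<phi> s p" 0] along[of "\<phi> \<alpha>" "D\<phi> \<alpha> p" 0] D\<phi>[OF _ U(2)] \<alpha> s
        by (intro has_vector_derivative_diff) auto
      show "integral (cbox \<alpha> s) (\<lambda>r. a r (p + \<tau> *\<^sub>R h)) = \<phi> s (p + \<tau> *\<^sub>R h) - \<phi> \<alpha> (p + \<tau> *\<^sub>R h)"
        if "\<tau> \<in> ball 0 r" for \<tau>
        using integral_unique[OF ftc[OF in_U[OF that]]] by simp
    next
      show "0 \<in> ball (0::real) r" using r by simp
    qed
    moreover have "at 0 within ball 0 r = at (0::real)"
      using r by (intro at_within_open) auto
    ultimately have "integral (cbox \<alpha> s) (\<lambda>r. Da r (p + 0 *\<^sub>R h) h) = D\<phi> s p h - D\<phi> \<alpha> p h"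
      using vector_derivative_unique_at by metis
    then show ?thesis by simp
  qed
  have "continuous_on {\<alpha>..t + 1} (\<lambda>s. (\<lambda>(s, q). Da s q h) (s, p))"
    using \<alpha> U by (intro continuous_on_compose2[OF cont] continuous_intros) auto
  then have "((\<lambda>s. integral {\<alpha>..s} (\<lambda>r. Da r p h)) has_vector_derivative Da t p h) (at t within {\<alpha>..t+1})"
    using \<alpha> by (intro integral_has_vector_derivative) auto
  then have "((\<lambda>s. D\<phi> \<alpha> p h + integral {\<alpha>..s} (\<lambda>r. Da r p h)) has_vector_derivative Da t p h)
      (at t within {\<alpha>..t+1})"
    by (auto intro!: derivative_eq_intros)
  then have "((\<lambda>s. D\<phi> s p h) has_vector_derivative Da t p h) (at t within {\<alpha>..t+1})"
  proof (rule has_vector_derivative_transform[rotated 2])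
    show "D\<phi> s p h = D\<phi> \<alpha> p h + integral {\<alpha>..s} (\<lambda>r. Da r p h)" if "s \<in> {\<alpha>..t+1}" for s
      using increment[of s] that by (simp add: algebra_simps)
  qed (use \<alpha> in simp)
  moreover have "at t within {\<alpha>..t+1} = at t"
    using \<alpha> by (intro at_within_interior) auto
  ultimately show ?thesis by simp
qed

section \<open>Differentiation under the integral sign\<close>

text \<open>The mean value theorem bounds the difference quotients by the majorant \<open>G\<close> of the derivative, and
  dominated convergence applies along every sequence of times that tends to \<open>t\<close>. The derivative \<open>f' t\<close>
  is measurable as a limit of difference quotients.\<close>

lemma has_real_derivative_integral_dominated:
  fixes f f' :: "real \<Rightarrow> 'a \<Rightarrow> real"
  assumes \<delta>: "\<delta> > 0"
    and f: "\<And>s x. \<bar>s - t\<bar> < \<delta> \<Longrightarrow> x \<in> space M \<Longrightarrow> ((\<lambda>s. f s x) has_real_derivative f' s x) (at s)"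
    and meas: "\<And>s. \<bar>s - t\<bar> < \<delta> \<Longrightarrow> f s \<in> borel_measurable M"
    and int: "integrable M (f t)"
    and dom: "integrable M G" "\<And>s x. \<bar>s - t\<bar> < \<delta> \<Longrightarrow> x \<in> space M \<Longrightarrow> \<bar>f' s x\<bar> \<le> G x"
  shows "((\<lambda>s. LINT x|M. f s x) has_real_derivative (LINT x|M. f' t x)) (at t)"
    and "integrable M (f' t)"
proof -
  have incr: "\<bar>f s x - f t x\<bar> \<le> G x * \<bar>s - t\<bar>" if "\<bar>s - t\<bar> < \<delta>" "x \<in> space M" for s x
  proof -
    have "norm (f s x - f t x) \<le> G x * norm (s - t)"
    proof (rule field_differentiable_bound[where S = "ball t \<delta>"
          and f = "\<lambda>s. f s x" and f' = "\<lambda>s. f' s x"])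
      show "((\<lambda>s. f s x) has_real_derivative f' z x) (at z within ball t \<delta>)" if "z \<in> ball t \<delta>" for z
        by (rule has_field_derivative_at_within[OF f])
          (use that \<open>x \<in> space M\<close> in \<open>auto simp: dist_real_def\<close>)
    qed (use that dom(2) \<delta> in \<open>auto simp: dist_real_def\<close>)
    then show ?thesis by simp
  qed
  have int_f: "integrable M (f s)" if s: "\<bar>s - t\<bar> < \<delta>" for s
  proof (rule Bochner_Integration.integrable_bound)
    show "integrable M (\<lambda>x. \<bar>f t x\<bar> + \<delta> * G x)"
      using int dom(1) by auto
    show "AE x in M. norm (f s x) \<le> norm (\<bar>f t x\<bar> + \<delta> * G x)"
    proof (rule AE_I2)
      fix x assume x: "x \<in> space M"
      have "G x \<ge> 0" using dom(2)[of t x] \<delta> x by auto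
      then have "G x * \<bar>s - t\<bar> \<le> \<delta> * G x"
        using s by (subst mult.commute) (intro mult_right_mono, auto)
      then show "norm (f s x) \<le> norm (\<bar>f t x\<bar> + \<delta> * G x)"
        using incr[OF s x] \<open>G x \<ge> 0\<close> \<delta> by auto
    qed
  qed (rule meas[OF s])
  have seq: "integrable M (f' t) \<and>
      (\<lambda>n. ((LINT x|M. f (X n) x) - (LINT x|M. f t x)) / (X n - t)) \<longlonglongrightarrow> (LINT x|M. f' t x)"
    if X: "\<And>n. X n \<noteq> t" "X \<longlonglongrightarrow> t" "\<And>n. \<bar>X n - t\<bar> < \<delta>" for X :: "nat \<Rightarrow> real"
  proof -
    define q where "q n x = (f (X n) x - f t x) / (X n - t)" for n x
    have q_meas: "q n \<in> borel_measurable M" for n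
      unfolding q_def using meas[OF X(3)] meas[of t] \<delta> by (intro borel_measurable_divide borel_measurable_diff) auto
    have q_lim: "(\<lambda>n. q n x) \<longlonglongrightarrow> f' t x" if x: "x \<in> space M" for x
      using f[of t x] \<delta> x X(1,2) unfolding has_field_derivative_iff tendsto_at_iff_sequentially
      by (auto simp: q_def o_def)
    have q_bound: "norm (q n x) \<le> G x" if x: "x \<in> space M" for n x
      using incr[OF X(3)[of n] x] X(1)[of n] by (auto simp: q_def divide_le_eq)
    have f'_meas: "f' t \<in> borel_measurable M"
      by (rule borel_measurable_LIMSEQ_real[OF q_lim q_meas])
    have *: "(LINT x|M. q n x) = ((LINT x|M. f (X n) x) - (LINT x|M. f t x)) / (X n - t)" for n
      unfolding q_def using int_f[OF X(3)[of n]] int by simp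
    have lims: "AE x in M. (\<lambda>n. q n x) \<longlonglongrightarrow> f' t x" "\<And>n. AE x in M. norm (q n x) \<le> G x"
      using q_lim q_bound by auto
    show ?thesis
      using integrable_dominated_convergence[OF f'_meas q_meas dom(1) lims]
        integral_dominated_convergence[OF f'_meas q_meas dom(1) lims] by (simp add: *)
  qed
  have X0: "(\<lambda>n. t + \<delta> / real (n + 2)) \<longlonglongrightarrow> t"
    using tendsto_add[OF tendsto_const LIMSEQ_ignore_initial_segment[OF lim_const_over_n[of \<delta>], of 2], of t]
    by simp
  show "integrable M (f' t)"
    using \<delta> by (intro conjunct1[OF seq[OF _ X0]]) (auto simp: field_simps intro!: add_pos_nonneg)
  show "((\<lambda>s. LINT x|M. f s x) has_real_derivative (LINT x|M. f' t x)) (at t)"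
    \<comment> \<open>A sequence that tends to \<open>t\<close> is eventually inside the interval, so a shift of it is covered.\<close>
    unfolding has_field_derivative_iff tendsto_at_iff_sequentially
  proof (intro allI impI)
    fix X :: "nat \<Rightarrow> real"
    assume X: "\<forall>i. X i \<in> UNIV - {t}" "X \<longlonglongrightarrow> t"
    obtain N where N: "\<And>n. n \<ge> N \<Longrightarrow> \<bar>X n - t\<bar> < \<delta>"
      using X(2) \<delta> unfolding lim_sequentially dist_real_def by blast
    have "(\<lambda>n. ((LINT x|M. f (X (n + N)) x) - (LINT x|M. f t x)) / (X (n + N) - t))
        \<longlonglongrightarrow> (LINT x|M. f' t x)"
      using X N by (intro conjunct2[OF seq]) (auto intro: LIMSEQ_ignore_initial_segment)
    then show "((\<lambda>y. ((LINT x|M. f y x) - (LINT x|M. f t x)) / (y - t)) \<circ> X) \<longlonglongrightarrow> (LINT x|M. f' t x)"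
      unfolding o_def by (rule LIMSEQ_offset)
  qed
qed

section \<open>Integration by parts and weak derivatives\<close>

lemma integral_lborel_translation:
  fixes F :: "'a::euclidean_space \<Rightarrow> real"
  assumes "F \<in> borel_measurable borel"
  shows "(LINT x|lborel. F (x + c)) = (LINT x|lborel. F x)"
proof -
  have "(LINT x|lborel. F x) = (LINT x|distr lborel borel ((+) c). F x)"
    by (simp add: lborel_distr_plus)
  also have "\<dots> = (LINT x|lborel. F (c + x))"
    using assms by (intro integral_distr) auto
  finally show ?thesis by (simp add: add.commute)
qed

text \<open>The integral of \<open>F (x + s *\<^sub>R h)\<close> over the whole space does not depend on \<open>s\<close>, by translation
  invariance. Its derivative at \<open>s = 0\<close> is the integral in question.\<close>

lemma integral_directional_derivative_eq_0:
  fixes F :: "'a::euclidean_space \<Rightarrow> real"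
  assumes F: "\<And>x. (F has_derivative F' x) (at x)"
    and cont: "continuous_on UNIV (\<lambda>x. F' x h)"
    and K: "compact K" "\<And>x. x \<notin> K \<Longrightarrow> F x = 0"
  shows "(LINT x|lborel. F' x h) = 0"
proof -
  have F_cont: "continuous_on UNIV F"
    by (rule has_derivative_continuous_on[OF has_derivative_at_withinI[OF F]])
  have F'_0: "F' x h = 0" if "x \<notin> K" for x
  proof -
    have "(F has_derivative (\<lambda>_. 0)) (at x)"
      by (rule has_derivative_transform_within_open[OF has_derivative_const, of "- K"])
        (use K that in \<open>auto simp: compact_imp_closed\<close>)
    then show ?thesis
      using has_derivative_unique[OF F] by metis
  qed
  obtain R where R: "\<And>x. x \<in> K \<Longrightarrow> norm x \<le> R"
    using compact_imp_bounded[OF K(1)] by (auto simp: bounded_iff)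
  have "compact ((\<lambda>x. F' x h) ` K)"
    by (rule compact_continuous_image[OF continuous_on_subset[OF cont] K(1)]) auto
  then obtain C where "\<And>x. x \<in> K \<Longrightarrow> \<bar>F' x h\<bar> \<le> C"
    using compact_imp_bounded by (fastforce simp: bounded_iff)
  then have C: "\<bar>F' x h\<bar> \<le> \<bar>C\<bar>" for x
    by (cases "x \<in> K") (fastforce simp: F'_0)+
  have F_integrable: "integrable lborel F"
  proof -
    have "(\<lambda>x. indicator K x *\<^sub>R F x) = F"
      using K by (auto simp: indicator_def fun_eq_iff)
    then show ?thesis
      using borel_integrable_compact[OF K(1) continuous_on_subset[OF F_cont]] by simp
  qed
  \<comment> \<open>For \<open>s\<close> between -1 and 1 the translates of the support stay inside a fixed ball, which provides an
      integrable majorant.\<close>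
  have "((\<lambda>s. LINT x|lborel. F (x + s *\<^sub>R h)) has_real_derivative
      (LINT x|lborel. F' (x + 0 *\<^sub>R h) h)) (at 0)"
  proof (rule has_real_derivative_integral_dominated(1)[where \<delta> = 1
        and f' = "\<lambda>s x. F' (x + s *\<^sub>R h) h"
        and G = "\<lambda>x. \<bar>C\<bar> * indicator (cball 0 (R + norm h)) x"])
    fix s :: real and x :: 'a
    assume s: "\<bar>s - 0\<bar> < 1"
    have "((\<lambda>s. x + s *\<^sub>R h) has_derivative (\<lambda>\<tau>. \<tau> *\<^sub>R h)) (at s)"
      by (auto intro!: derivative_eq_intros)
    from diff_chain_at[OF this F]
    have "((\<lambda>s. F (x + s *\<^sub>R h)) has_derivative (\<lambda>\<tau>. F' (x + s *\<^sub>R h) (\<tau> *\<^sub>R h))) (at s)"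
      by (simp add: o_def)
    then show "((\<lambda>s. F (x + s *\<^sub>R h)) has_real_derivative F' (x + s *\<^sub>R h) h) (at s)"
      using has_derivative_linear[OF F] by (simp add: has_field_derivative_def linear_scale mult_commute_abs)
    show "\<bar>F' (x + s *\<^sub>R h) h\<bar> \<le> \<bar>C\<bar> * indicator (cball 0 (R + norm h)) x"
    proof (cases "x + s *\<^sub>R h \<in> K")
      case True
      have "norm x \<le> norm (x + s *\<^sub>R h) + norm (s *\<^sub>R h)"
        using norm_triangle_ineq4[of "x + s *\<^sub>R h" "s *\<^sub>R h"] by simp
      also have "norm (s *\<^sub>R h) \<le> norm h"
        using s by (auto intro!: mult_left_le_one_le)
      finally have "norm x \<le> R + norm h"
        using R[OF True] by simp
      then show ?thesis using C by simp
    qed (simp add: F'_0)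
  next
    fix s :: real
    show "(\<lambda>x. F (x + s *\<^sub>R h)) \<in> borel_measurable lborel"
      using F_cont by (auto intro!: borel_measurable_continuous_onI continuous_on_compose2[OF F_cont] continuous_intros)
  next
    show "integrable lborel (\<lambda>x::'a. \<bar>C\<bar> * indicator (cball 0 (R + norm h)) x)"
      using emeasure_bounded_finite[OF bounded_cball, of "0::'a" "R + norm h"]
      by (intro integrable_mult_right integrable_real_indicator) auto
  qed (use F_integrable in auto)
  moreover have "(LINT x|lborel. F (x + s *\<^sub>R h)) = (LINT x|lborel. F x)" for s
    by (intro integral_lborel_translation borel_measurable_continuous_onI F_cont)
  ultimately show ?thesis
    using DERIV_unique[OF DERIV_const] by fastforce
qed

lemma set_integrable_compact_support:
  fixes f :: "'a::euclidean_space \<Rightarrow> real"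
  assumes "continuous_on D f" "compact K" "K \<subseteq> D" "\<And>x. x \<notin> K \<Longrightarrow> f x = 0"
  shows "set_integrable lebesgue D f"
proof -
  have "integrable lborel (\<lambda>x. indicator K x *\<^sub>R f x)"
    using assms by (intro borel_integrable_compact continuous_on_subset[OF assms(1)])
  moreover have "(\<lambda>x. indicator K x *\<^sub>R f x) = (\<lambda>x. indicator D x *\<^sub>R f x)"
    using assms by (auto simp: indicator_def fun_eq_iff)
  ultimately show ?thesis
    unfolding set_integrable_def by (metis integrable_completion borel_measurable_integrable)
qed

text \<open>The product \<open>v \<psi>\<close>, extended by 0 outside \<open>D\<close>, is continuously differentiable on the whole space
  because the support of \<open>\<psi>\<close> is a compact subset of the open set \<open>D\<close>. Its derivative in direction \<open>h\<close>
  therefore has integral 0.\<close>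

lemma integral_by_parts_compact_support:
  fixes v \<psi> :: "'a::euclidean_space \<Rightarrow> real"
  assumes D: "open D"
    and v: "\<And>x. x \<in> D \<Longrightarrow> (v has_derivative v' x) (at x)" "continuous_on D (\<lambda>x. v' x h)"
    and \<psi>: "\<And>x. (\<psi> has_derivative \<psi>' x) (at x)" "continuous_on UNIV (\<lambda>x. \<psi>' x h)"
    and K: "compact K" "K \<subseteq> D" "\<And>x. x \<notin> K \<Longrightarrow> \<psi> x = 0"
  shows "(LINT x:D|lebesgue. v x * \<psi>' x h) = - (LINT x:D|lebesgue. v' x h * \<psi> x)"
proof -
  let ?F = "\<lambda>x. if x \<in> D then v x * \<psi> x else 0"
  let ?F' = "\<lambda>x k. if x \<in> D then v x * \<psi>' x k + v' x k * \<psi> x else 0"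
  have v_cont: "continuous_on D v"
    by (rule has_derivative_continuous_on[OF has_derivative_at_withinI[OF v(1)]])
  have \<psi>_cont: "continuous_on UNIV \<psi>"
    by (rule has_derivative_continuous_on[OF has_derivative_at_withinI[OF \<psi>(1)]])
  have K_open: "open (- K)"
    using K(1) by (simp add: compact_imp_closed open_Compl)
  have \<psi>'_0: "\<psi>' x k = 0" if "x \<notin> K" for x k
  proof -
    have "(\<psi> has_derivative (\<lambda>_. 0)) (at x)"
      by (rule has_derivative_transform_within_open[OF has_derivative_const K_open])
        (use K that in auto)
    then show ?thesis
      using has_derivative_unique[OF \<psi>(1)] by metis
  qed
  have cover: "UNIV = D \<union> - K"
    using K(2) by auto
  have int1: "set_integrable lebesgue D (\<lambda>x. v x * \<psi>' x h)"
    using K \<psi>'_0 by (intro set_integrable_compact_support[of _ _ K] continuous_intros v_cont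
        continuous_on_subset[OF \<psi>(2)]) auto
  have int2: "set_integrable lebesgue D (\<lambda>x. v' x h * \<psi> x)"
    using K by (intro set_integrable_compact_support[of _ _ K] continuous_intros v(2)
        continuous_on_subset[OF \<psi>_cont]) auto
  have F'_cont: "continuous_on UNIV (\<lambda>x. ?F' x h)"
    \<comment> \<open>Continuity is local, and the space is covered by \<open>D\<close> and the complement of the support, both open.\<close>
    unfolding cover
  proof (rule continuous_on_open_Un[OF D K_open])
    have "continuous_on D (\<lambda>x. v x * \<psi>' x h + v' x h * \<psi> x)"
      by (intro continuous_intros v_cont v(2) continuous_on_subset[OF \<psi>(2)]
          continuous_on_subset[OF \<psi>_cont]) auto
    then show "continuous_on D (\<lambda>x. ?F' x h)"
      by (rule continuous_on_eq) simp
    show "continuous_on (- K) (\<lambda>x. ?F' x h)"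
      by (rule continuous_on_eq[OF continuous_on_const[of _ 0]]) (auto simp: \<psi>'_0 K)
  qed
  have F_deriv: "(?F has_derivative ?F' x) (at x)" for x
  proof (cases "x \<in> D")
    case True
    have "((\<lambda>x. v x * \<psi> x) has_derivative (\<lambda>k. v x * \<psi>' x k + v' x k * \<psi> x)) (at x)"
      by (rule has_derivative_mult[OF v(1)[OF True] \<psi>(1)])
    then have "(?F has_derivative (\<lambda>k. v x * \<psi>' x k + v' x k * \<psi> x)) (at x)"
      by (rule has_derivative_transform_within_open[OF _ D True]) simp
    with True show ?thesis by simp
  next
    case False
    have "(?F has_derivative (\<lambda>_. 0)) (at x)"
      by (rule has_derivative_transform_within_open[OF has_derivative_const K_open])
        (use K False in auto)
    with False show ?thesis by simp
  qed
  have "0 = (LINT x|lborel. ?F' x h)"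
    by (rule integral_directional_derivative_eq_0[OF F_deriv F'_cont K(1), symmetric]) (use K in auto)
  also have "\<dots> = (LINT x|lebesgue. ?F' x h)"
    using borel_measurable_continuous_onI[OF F'_cont] by (intro integral_completion[symmetric]) simp
  also have "\<dots> = (LINT x:D|lebesgue. v x * \<psi>' x h + v' x h * \<psi> x)"
    unfolding set_lebesgue_integral_def by (intro Bochner_Integration.integral_cong) auto
  also have "\<dots> = (LINT x:D|lebesgue. v x * \<psi>' x h) + (LINT x:D|lebesgue. v' x h * \<psi> x)"
    by (rule set_integral_add[OF int1 int2])
  finally show ?thesis by simp
qed

lemma absolutely_integrable_on_compact:
  fixes f :: "'a::euclidean_space \<Rightarrow> 'b::euclidean_space"
  assumes "compact K" "continuous_on K f"
  shows "f absolutely_integrable_on K"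
  unfolding set_integrable_def
  using borel_integrable_compact[OF assms] by (metis integrable_completion borel_measurable_integrable)

lemma classical_imp_weak_jacobian:
  fixes v :: "real^'n \<Rightarrow> real^'n"
  assumes D: "open D"
    and v: "\<And>x. x \<in> D \<Longrightarrow> v differentiable (at x)"
    and cont: "continuous_on D (\<lambda>x. jacobian v (at x))"
  shows "has_weak_jacobian D v (\<lambda>x. jacobian v (at x))"
  unfolding has_weak_jacobian_def
proof (intro conjI allI impI ballI)
  have "continuous_on D v"
    using v by (auto intro!: differentiable_imp_continuous_on
      simp: differentiable_on_def differentiable_at_withinI)
  then show "v absolutely_integrable_on K" if "compact K \<and> K \<subseteq> D" for K
    using that by (meson absolutely_integrable_on_compact continuous_on_subset)
  show "(\<lambda>x. jacobian v (at x)) absolutely_integrable_on K" if "compact K \<and> K \<subseteq> D" for K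
    using that cont by (meson absolutely_integrable_on_compact continuous_on_subset)
next
  fix \<psi> :: "real^'n \<Rightarrow> real" and i j :: 'n
  assume "\<psi> \<in> test_functions D"
  then obtain K where \<psi>: "C_k_on 1 UNIV \<psi>" and K: "compact K" "K \<subseteq> D" "\<And>x. x \<notin> K \<Longrightarrow> \<psi> x = 0"
    unfolding test_functions_def by blast
  have comp: "((\<lambda>x. v x $ i) has_derivative (\<lambda>k. (jacobian v (at x) *v k) $ i)) (at x)" if "x \<in> D" for x
    using v[OF that] unfolding jacobian_works
    by (rule bounded_linear.has_derivative[OF bounded_linear_vec_nth])
  have entry: "(jacobian v (at x) *v axis j 1) $ i = jacobian v (at x) $ i $ j" for x
    by (simp add: matrix_vector_mul_component inner_axis)
  have "(LINT x:D|lebesgue. v x $ i * frechet_derivative \<psi> (at x) (axis j 1))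
      = - (LINT x:D|lebesgue. (jacobian v (at x) *v axis j 1) $ i * \<psi> x)"
  proof (rule integral_by_parts_compact_support[OF D comp _ _ _ K])
    show "continuous_on D (\<lambda>x. (jacobian v (at x) *v axis j 1) $ i)"
      unfolding entry by (intro continuous_intros cont)
    show "continuous_on UNIV (\<lambda>x. frechet_derivative \<psi> (at x) (axis j 1))"
      by (rule C1_on_continuous_derivative[OF \<psi> continuous_on_const])
    show "(\<psi> has_derivative frechet_derivative \<psi> (at x)) (at x)" for x
      by (rule C1_onD[OF \<psi>]) simp
  qed
  then show "(LINT x:D|lebesgue. v x $ i * frechet_derivative \<psi> (at x) (axis j 1))
      = - (LINT x:D|lebesgue. jacobian v (at x) $ i $ j * \<psi> x)"
    by (simp add: entry)
qed

lemma L2_of_continuous_dominated: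
  fixes f :: "'a::euclidean_space \<Rightarrow> 'b::euclidean_space" and g :: "'a \<Rightarrow> real"
  assumes D: "open D" and f: "continuous_on D f" and g: "g \<in> L2 D"
    and bound: "\<And>x. x \<in> D \<Longrightarrow> norm (f x) \<le> g x"
  shows "f \<in> L2 D"
proof -
  have D_meas: "D \<in> sets lebesgue" using D by simp
  have meas: "f \<in> borel_measurable (lebesgue_on D)"
    by (rule continuous_imp_measurable_on_sets_lebesgue[OF f D_meas])
  have "(\<lambda>x. (norm (f x))\<^sup>2) absolutely_integrable_on D"
  proof (rule measurable_bounded_by_integrable_imp_absolutely_integrable[OF _ D_meas])
    show "(\<lambda>x. (norm (f x))\<^sup>2) \<in> borel_measurable (lebesgue_on D)"
      using meas by measurable
    show "(\<lambda>x. (norm (g x))\<^sup>2) integrable_on D"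
      using g by (auto simp: L2_def intro: set_lebesgue_integral_eq_integral(1))
    show "norm ((norm (f x))\<^sup>2) \<le> (norm (g x))\<^sup>2" if "x \<in> D" for x
      using bound[OF that] by (auto intro!: power_mono)
  qed
  with meas show ?thesis by (simp add: L2_def)
qed

section \<open>Pulling integrals back along the flow\<close>

text \<open>The change of variables formula for integrals of vectors, read for vectors with one component and
  in terms of the Lebesgue integral. Where the function is not integrable both integrals are 0 by
  convention, so the second equation is unconditional.\<close>

lemma set_integral_change_of_variables:
  fixes f :: "real^'n::{finite,wellorder} \<Rightarrow> real" and g :: "real^'n::_ \<Rightarrow> real^'n::_"
  assumes S: "open S"
    and g: "\<And>x. x \<in> S \<Longrightarrow> (g has_derivative g' x) (at x)" "inj_on g S"
  shows "integrable (lebesgue_on S) (\<lambda>x. \<bar>det (matrix (g' x))\<bar> * f (g x))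
           \<longleftrightarrow> f absolutely_integrable_on (g ` S)" (is "?I \<longleftrightarrow> ?A")
    and "(LINT y:g ` S|lebesgue. f y) = (LINT x|lebesgue_on S. \<bar>det (matrix (g' x))\<bar> * f (g x))"
proof -
  let ?D = "\<lambda>x. \<bar>det (matrix (g' x))\<bar> * f (g x)"
  have S_meas: "S \<in> sets lebesgue"
    using S by simp
  have eq: "?D absolutely_integrable_on S \<and> integral S ?D = b
      \<longleftrightarrow> f absolutely_integrable_on (g ` S) \<and> integral (g ` S) f = b" for b
  proof -
    have "(\<lambda>x. \<bar>det (matrix (g' x))\<bar> *\<^sub>R vec (f (g x)) :: real^1) absolutely_integrable_on S \<and>
          integral S (\<lambda>x. \<bar>det (matrix (g' x))\<bar> *\<^sub>R vec (f (g x))) = (vec b :: real^1)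
        \<longleftrightarrow> (\<lambda>x. vec (f x) :: real^1) absolutely_integrable_on (g ` S) \<and>
          integral (g ` S) (\<lambda>x. vec (f x)) = (vec b :: real^1)"
      by (rule has_absolute_integral_change_of_variables[OF S_meas _ g(2)])
        (rule has_derivative_at_withinI[OF g(1)])
    then show ?thesis
      by (simp add: absolutely_integrable_on_1_iff integral_on_1_eq)
  qed
  have on: "?I \<longleftrightarrow> ?D absolutely_integrable_on S"
    using S_meas by (simp add: set_integrable_def integrable_restrict_space)
  show iff: "?I \<longleftrightarrow> ?A"
    unfolding on using eq by blast
  show "(LINT y:g ` S|lebesgue. f y) = (LINT x|lebesgue_on S. ?D x)"
  proof (cases ?A)
    case True
    then have "?I" using iff by simp
    have "(LINT y:g ` S|lebesgue. f y) = integral (g ` S) f"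
      by (rule set_lebesgue_integral_eq_integral(2)[OF True])
    also have "\<dots> = integral S ?D"
      using eq True by blast
    also have "\<dots> = (LINT x|lebesgue_on S. ?D x)"
      by (rule lebesgue_integral_eq_integral[OF \<open>?I\<close> S_meas, symmetric])
    finally show ?thesis .
  next
    case False
    with iff have "\<not> ?I" by simp
    with False show ?thesis
      by (simp add: set_lebesgue_integral_def set_integrable_def not_integrable_integral_eq)
  qed
qed

locale regular_motion =
  fixes \<Omega> :: "real \<Rightarrow> (real^'n::{finite,wellorder}) set"
    and w \<phi> :: "real \<Rightarrow> real^'n::_ \<Rightarrow> real^'n::_"
  assumes motion: "driven_by {0..} \<Omega> w \<phi>"
    and flow_C1: "C_k_on 1 ({0<..} \<times> \<Omega> 0) (\<lambda>(t, p). \<phi> t p)"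
    and velocity: "regular_velocity {0..} \<Omega> w \<phi>"
begin

abbreviation space_time :: "(real \<times> (real^'n::_)) set" where
  "space_time \<equiv> {(t, x). t \<in> {0<..} \<and> x \<in> \<Omega> t}"

lemma open_initial: "open (\<Omega> 0)"
  and \<Omega>_eq: "t \<ge> 0 \<Longrightarrow> \<Omega> t = \<phi> t ` \<Omega> 0"
  and frontier_eq: "t \<ge> 0 \<Longrightarrow> frontier (\<Omega> t) = \<phi> t ` frontier (\<Omega> 0)"
  using motion unfolding driven_by_def atLeast_iff by blast+

lemma flow_homeomorphism:
  assumes "t \<ge> 0"
  obtains g where "homeomorphism (closure (\<Omega> 0)) (closure (\<Omega> t)) (\<phi> t) g"
  using motion assms unfolding driven_by_def atLeast_iff by blast

lemma inj_on_flow: "t \<ge> 0 \<Longrightarrow> inj_on (\<phi> t) (closure (\<Omega> 0))"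
  by (metis flow_homeomorphism homeomorphism_apply1 inj_on_inverseI)

lemma flow_in: "t \<ge> 0 \<Longrightarrow> p \<in> \<Omega> 0 \<Longrightarrow> \<phi> t p \<in> \<Omega> t"
  using \<Omega>_eq by blast

text \<open>The flow map is injective on the closure of \<open>\<Omega> 0\<close>, so it keeps the image of the boundary disjoint
  from the image of the open set; the former is the boundary of \<open>\<Omega> t\<close>.\<close>

lemma open_\<Omega>:
  assumes "t \<ge> 0"
  shows "open (\<Omega> t)"
proof -
  have "frontier (\<Omega> 0) \<inter> \<Omega> 0 = {}"
    using open_initial frontier_disjoint_eq by blast
  moreover have "frontier (\<Omega> 0) \<subseteq> closure (\<Omega> 0)" "\<Omega> 0 \<subseteq> closure (\<Omega> 0)"
    by (auto simp: frontier_def closure_subset)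
  ultimately have "frontier (\<Omega> t) \<inter> \<Omega> t = {}"
    using inj_on_image_Int[OF inj_on_flow[OF assms]] frontier_eq[OF assms] \<Omega>_eq[OF assms]
    by (metis image_empty)
  then show ?thesis
    by (simp add: frontier_disjoint_eq)
qed

lemma flow_ode:
  assumes "s > 0" "p \<in> \<Omega> 0"
  shows "((\<lambda>s. \<phi> s p) has_vector_derivative w s (\<phi> s p)) (at s)"
proof -
  have "((\<lambda>s. \<phi> s p) has_vector_derivative w s (\<phi> s p)) (at s within {0..})"
    using motion assms closure_subset[of "\<Omega> 0"] less_imp_le[OF assms(1)]
    unfolding driven_by_def atLeast_iff by blast
  moreover have "at s within {0..} = at s"
    using assms by (intro at_within_interior) auto
  ultimately show ?thesis by simp
qed

lemma velocity_C1: "C_k_on 1 space_time (\<lambda>(t, x). w t x)"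
  using velocity unfolding regular_velocity_def interior_real_atLeast by blast

definition dw :: "real \<times> (real^'n::_) \<Rightarrow> real \<times> (real^'n::_) \<Rightarrow> real^'n::_" where
  "dw z = frechet_derivative (\<lambda>(t, x). w t x) (at z)"

lemma velocity_deriv:
  assumes "s > 0" "x \<in> \<Omega> s"
  shows "((\<lambda>(t, x). w t x) has_derivative dw (s, x)) (at (s, x))"
  unfolding dw_def using assms by (intro C1_onD[OF velocity_C1]) auto

lemma velocity_space_deriv:
  assumes "s > 0" "x \<in> \<Omega> s"
  shows "(w s has_derivative (\<lambda>h. dw (s, x) (0, h))) (at x)"
proof -
  have "((\<lambda>x. (s, x)) has_derivative (\<lambda>h. (0, h))) (at x)"
    by (auto intro!: derivative_eq_intros)
  from diff_chain_at[OF this velocity_deriv[OF assms]] show ?thesis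
    by (simp add: o_def)
qed

lemma jacobian_velocity:
  assumes "s > 0" "x \<in> \<Omega> s"
  shows "jacobian (w s) (at x) *v h = dw (s, x) (0, h)"
proof -
  have "frechet_derivative (w s) (at x) = (\<lambda>h. dw (s, x) (0, h))"
    using velocity_space_deriv[OF assms] by (metis frechet_derivative_at)
  then show ?thesis
    using has_derivative_linear[OF velocity_space_deriv[OF assms]]
    by (simp add: jacobian_def matrix_works)
qed

text \<open>The rate of change of the velocity seen by an observer who moves along a curve \<open>c\<close>. Constant curves
  give the partial derivative in time and trajectories of the flow the material derivative.\<close>

lemma velocity_along:
  assumes s: "s > 0" "x \<in> \<Omega> s"
    and c: "(c has_vector_derivative d) (at s)" "c s = x"
  shows "((\<lambda>r. w r (c r)) has_vector_derivative dw (s, x) (1, d)) (at s)"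
proof -
  have "((\<lambda>r. (r, c r)) has_derivative (\<lambda>k. (k, k *\<^sub>R d))) (at s)"
    using c(1) unfolding has_vector_derivative_def by (auto intro!: derivative_eq_intros)
  from diff_chain_at[OF this, of "\<lambda>(t, x). w t x" "dw (s, x)"] velocity_deriv[OF s] c(2)
  have "((\<lambda>r. w r (c r)) has_derivative (\<lambda>k. dw (s, x) (k, k *\<^sub>R d))) (at s)"
    by (simp add: o_def)
  moreover have "dw (s, x) (k, k *\<^sub>R d) = k *\<^sub>R dw (s, x) (1, d)" for k
    using has_derivative_linear[OF velocity_deriv[OF s]] linear_scale[of "dw (s, x)" k "(1, d)"] by simp
  ultimately show ?thesis
    by (simp add: has_vector_derivative_def)
qed

lemma velocity_time_deriv:
  assumes "s > 0" "x \<in> \<Omega> s"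
  shows "((\<lambda>r. w r x) has_vector_derivative dw (s, x) (1, 0)) (at s)"
  using assms by (intro velocity_along) auto

lemma material_derivative_velocity:
  assumes s: "s > 0" "x \<in> \<Omega> s"
  shows "material_derivative w w s x = dw (s, x) (1, w s x)"
proof -
  have "frechet_derivative (w s) (at x) = (\<lambda>h. dw (s, x) (0, h))"
    using velocity_space_deriv[OF s] by (metis frechet_derivative_at)
  then have "material_derivative w w s x = dw (s, x) (1, 0) + dw (s, x) (0, w s x)"
    using velocity_time_deriv[OF s] by (simp add: material_derivative_def vector_derivative_at)
  also have "\<dots> = dw (s, x) (1, w s x)"
    using has_derivative_linear[OF velocity_deriv[OF s]] linear_add[of "dw (s, x)" "(1, 0)" "(0, w s x)"] by simp
  finally show ?thesis .
qed

lemma velocity_along_flow: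
  assumes "s > 0" "p \<in> \<Omega> 0"
  shows "((\<lambda>s. w s (\<phi> s p)) has_vector_derivative material_derivative w w s (\<phi> s p)) (at s)"
  using assms by (simp add: material_derivative_velocity flow_in velocity_along flow_ode)

lemma velocity_continuous:
  assumes "s > 0"
  shows "continuous_on (\<Omega> s) (w s)"
  using has_derivative_at_withinI[OF velocity_space_deriv[OF assms]] by (rule has_derivative_continuous_on)

lemma jacobian_velocity_continuous:
  "continuous_on space_time (\<lambda>(s, x). jacobian (w s) (at x))"
proof -
  have "continuous_on space_time (\<lambda>z. \<chi> i j. dw z (0, axis j 1) $ i)"
    unfolding dw_def
    by (intro continuous_intros C1_on_continuous_derivative[OF velocity_C1])
  then show ?thesis
  proof (rule continuous_on_eq)
    fix z assume z: "z \<in> space_time"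
    have "dw z (0, axis j 1) $ i = jacobian (w (fst z)) (at (snd z)) $ i $ j" for i j
    proof -
      have "dw z (0, axis j 1) = jacobian (w (fst z)) (at (snd z)) *v axis j 1"
        using z by (subst jacobian_velocity) auto
      then show ?thesis
        by (simp add: matrix_vector_mul_component inner_axis)
    qed
    then show "(\<chi> i j. dw z (0, axis j 1) $ i) = (case z of (s, x) \<Rightarrow> jacobian (w s) (at x))"
      by (simp add: vec_eq_iff case_prod_beta)
  qed
qed

lemma jacobian_velocity_continuous_space:
  assumes "s > 0"
  shows "continuous_on (\<Omega> s) (\<lambda>x. jacobian (w s) (at x))"
proof -
  have "continuous_on (\<Omega> s) (\<lambda>x. (\<lambda>(s, x). jacobian (w s) (at x)) (s, x))"
    using assms by (intro continuous_on_compose2[OF jacobian_velocity_continuous] continuous_intros) auto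
  then show ?thesis by simp
qed

text \<open>The derivative of the flow is taken jointly in time and space, where it is known to be continuous,
  and then restricted to spatial directions.\<close>

definition d\<phi> :: "real \<Rightarrow> real^'n::_ \<Rightarrow> real^'n::_ \<Rightarrow> real^'n::_" where
  "d\<phi> s p h = frechet_derivative (\<lambda>(t, p). \<phi> t p) (at (s, p)) (0, h)"

lemma flow_deriv:
  assumes "s > 0" "p \<in> \<Omega> 0"
  shows "(\<phi> s has_derivative d\<phi> s p) (at p)"
proof -
  have pair: "((\<lambda>x. (s, x)) has_derivative (\<lambda>h. (0, h))) (at p)"
    by (auto intro!: derivative_eq_intros)
  have "((\<lambda>(t, p). \<phi> t p) has_derivative frechet_derivative (\<lambda>(t, p). \<phi> t p) (at (s, p))) (at (s, p))"
    using assms by (intro C1_onD[OF flow_C1]) auto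
  from diff_chain_at[OF pair this] show ?thesis
    by (simp add: o_def d\<phi>_def[abs_def])
qed

lemma flow_continuous: "continuous_on ({0<..} \<times> \<Omega> 0) (\<lambda>(s, p). \<phi> s p)"
  by (rule C1_on_continuous[OF flow_C1])

lemma d\<phi>_continuous: "continuous_on ({0<..} \<times> \<Omega> 0) (\<lambda>(s, p). d\<phi> s p h)"
proof -
  have "continuous_on ({0<..} \<times> \<Omega> 0) (\<lambda>z. frechet_derivative (\<lambda>(t, p). \<phi> t p) (at z) (0, h))"
    by (rule C1_on_continuous_derivative[OF flow_C1 continuous_on_const])
  then show ?thesis
    by (simp add: d\<phi>_def case_prod_beta)
qed

definition volume_factor :: "real \<Rightarrow> real^'n::_ \<Rightarrow> real" where
  "volume_factor s p = \<bar>det (matrix (d\<phi> s p))\<bar>"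

lemma gradient_along_flow_continuous:
  "continuous_on ({0<..} \<times> \<Omega> 0) (\<lambda>(s, p). jacobian (w s) (at (\<phi> s p)))"
proof -
  have "continuous_on ({0<..} \<times> \<Omega> 0) (\<lambda>z. (\<lambda>(s, x). jacobian (w s) (at x)) (fst z, \<phi> (fst z) (snd z)))"
    using flow_continuous flow_in
    by (intro continuous_on_compose2[OF jacobian_velocity_continuous] continuous_intros)
      (auto simp: case_prod_beta)
  then show ?thesis by (simp add: case_prod_beta)
qed

text \<open>The right-hand side of the flow equation, \<open>w s (\<phi> s q)\<close> as a function of \<open>q\<close>, has the derivative
  \<open>\<nabla>w d\<phi>\<close> by the chain rule.\<close>

lemma d\<phi>_ode:
  assumes "t > 0" "p \<in> \<Omega> 0"
  shows "((\<lambda>s. d\<phi> s p h) has_vector_derivative jacobian (w t) (at (\<phi> t p)) *v d\<phi> t p h) (at t)"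
proof (rule flow_derivative_ode[OF open_initial assms(2,1), where \<phi> = \<phi>
      and a = "\<lambda>s q. w s (\<phi> s q)" and Da = "\<lambda>s q h. jacobian (w s) (at (\<phi> s q)) *v d\<phi> s q h"])
  show "((\<lambda>q. w s (\<phi> s q)) has_derivative (\<lambda>h. jacobian (w s) (at (\<phi> s q)) *v d\<phi> s q h)) (at q)"
    if "0 < s" "q \<in> \<Omega> 0" for s q
    using diff_chain_at[OF flow_deriv[OF that] velocity_space_deriv[OF that(1) flow_in]] that
    by (simp add: o_def jacobian_velocity flow_in)
  have "continuous_on ({0<..} \<times> \<Omega> 0) (\<lambda>z. \<chi> i. \<Sum>j\<in>UNIV.
      (\<lambda>(s, p). jacobian (w s) (at (\<phi> s p))) z $ i $ j * (\<lambda>(s, p). d\<phi> s p h) z $ j)"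
    by (intro continuous_intros gradient_along_flow_continuous d\<phi>_continuous)
  then show "continuous_on ({0<..} \<times> \<Omega> 0) (\<lambda>(s, q). jacobian (w s) (at (\<phi> s q)) *v d\<phi> s q h)"
    by (simp add: matrix_vector_mult_def case_prod_beta)
qed (use flow_ode flow_deriv in auto)

text \<open>The divergence is the relative rate of change of volume.\<close>

lemma volume_factor_ode:
  assumes t: "t > 0" and p: "p \<in> \<Omega> 0"
  shows "((\<lambda>s. volume_factor s p) has_real_derivative divergence (w t) (\<phi> t p) * volume_factor t p) (at t)"
  unfolding volume_factor_def
proof (rule abs_linear_ode[OF t])
  fix s :: real assume s: "s > 0"
  have "((\<lambda>s. matrix (d\<phi> s p) $ i $ j) has_real_derivative
      (jacobian (w s) (at (\<phi> s p)) ** matrix (d\<phi> s p)) $ i $ j) (at s)" for i j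
  proof -
    have "((\<lambda>s. d\<phi> s p (axis j 1) $ i) has_vector_derivative
        (jacobian (w s) (at (\<phi> s p)) *v d\<phi> s p (axis j 1)) $ i) (at s)"
      using bounded_linear.has_vector_derivative[OF bounded_linear_vec_nth d\<phi>_ode[OF s p]] .
    then show ?thesis
      by (simp add: has_real_derivative_iff_has_vector_derivative matrix_def
          matrix_matrix_mult_def matrix_vector_mult_def)
  qed
  then show "((\<lambda>s. det (matrix (d\<phi> s p))) has_real_derivative
      divergence (w s) (\<phi> s p) * det (matrix (d\<phi> s p))) (at s)"
    unfolding divergence_def by (rule has_field_derivative_det_linear_ode)
next
  have "continuous_on {0<..} (\<lambda>s. (\<lambda>(s, p). jacobian (w s) (at (\<phi> s p))) (s, p))"
    using p by (intro continuous_on_compose2[OF gradient_along_flow_continuous] continuous_intros) auto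
  then show "continuous_on {0<..} (\<lambda>s. divergence (w s) (\<phi> s p))"
    unfolding divergence_def by (intro continuous_intros) simp
qed

lemma flow_change_of_variables:
  fixes f :: "real^'n::_ \<Rightarrow> real"
  assumes "s > 0"
  shows "integrable (lebesgue_on (\<Omega> 0)) (\<lambda>p. volume_factor s p * f (\<phi> s p)) \<longleftrightarrow> f absolutely_integrable_on \<Omega> s"
    and "(LINT x:\<Omega> s|lebesgue. f x) = (LINT p|lebesgue_on (\<Omega> 0). volume_factor s p * f (\<phi> s p))"
proof -
  have inj: "inj_on (\<phi> s) (\<Omega> 0)"
    using inj_on_flow[of s] assms closure_subset inj_on_subset by (metis less_imp_le)
  show "integrable (lebesgue_on (\<Omega> 0)) (\<lambda>p. volume_factor s p * f (\<phi> s p)) \<longleftrightarrow> f absolutely_integrable_on \<Omega> s"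
    "(LINT x:\<Omega> s|lebesgue. f x) = (LINT p|lebesgue_on (\<Omega> 0). volume_factor s p * f (\<phi> s p))"
    using set_integral_change_of_variables[OF open_initial flow_deriv[OF assms] inj] assms
    by (simp_all add: volume_factor_def \<Omega>_eq[of s])
qed

section \<open>The Reynolds transport theorem\<close>

text \<open>\<open>F'\<close> is the material derivative of \<open>F\<close>, described by the values of \<open>F\<close> along trajectories. On the
  fixed domain \<open>\<Omega> 0\<close> the integrand is \<open>volume_factor s p * F s (\<phi> s p)\<close>, whose time derivative is
  \<open>volume_factor s p * (F' + F div w)\<close>. The majorant \<open>g\<close> lives at the fixed time \<open>t\<close>, where its
  integrability over \<open>\<Omega> t\<close> is that of \<open>volume_factor t p * g (\<phi> t p)\<close> over \<open>\<Omega> 0\<close>; the bound \<open>K\<close> on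
  the divergence bounds the volume factor at time \<open>s\<close> by a multiple of the one at time \<open>t\<close>.\<close>

lemma reynolds_transport:
  fixes F F' :: "real \<Rightarrow> real^'n::_ \<Rightarrow> real" and g :: "real^'n::_ \<Rightarrow> real"
  assumes t: "t > 0" and \<delta>: "\<delta> > 0"
    and F: "\<And>s p. s > 0 \<Longrightarrow> \<bar>s - t\<bar> < \<delta> \<Longrightarrow> p \<in> \<Omega> 0 \<Longrightarrow>
      ((\<lambda>s. F s (\<phi> s p)) has_real_derivative F' s (\<phi> s p)) (at s)"
    and cont: "\<And>s. s > 0 \<Longrightarrow> continuous_on (\<Omega> s) (F s)"
    and g: "g absolutely_integrable_on \<Omega> t"
    and F_le: "\<And>s p. s > 0 \<Longrightarrow> \<bar>s - t\<bar> < \<delta> \<Longrightarrow> p \<in> \<Omega> 0 \<Longrightarrow> \<bar>F s (\<phi> s p)\<bar> \<le> g (\<phi> t p)"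
    and F'_le: "\<And>s p. s > 0 \<Longrightarrow> \<bar>s - t\<bar> < \<delta> \<Longrightarrow> p \<in> \<Omega> 0 \<Longrightarrow> \<bar>F' s (\<phi> s p)\<bar> \<le> g (\<phi> t p)"
    and div_le: "\<And>s p. s > 0 \<Longrightarrow> \<bar>s - t\<bar> < \<delta> \<Longrightarrow> p \<in> \<Omega> 0 \<Longrightarrow>
      \<bar>divergence (w s) (\<phi> s p)\<bar> \<le> K"
  shows "((\<lambda>s. LINT x:\<Omega> s|lebesgue. F s x) has_real_derivative
           (LINT x:\<Omega> t|lebesgue. F' t x + F t x * divergence (w t) x)) (at t)"
    and "(\<lambda>x. F' t x + F t x * divergence (w t) x) absolutely_integrable_on \<Omega> t"
proof -
  \<comment> \<open>With this radius all nearby times are positive.\<close>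
  define r where "r = min \<delta> t"
  have r: "r > 0" using t \<delta> by (simp add: r_def)
  have near: "s > 0" "\<bar>s - t\<bar> < \<delta>" if "\<bar>s - t\<bar> < r" for s
    using that by (auto simp: r_def)
  have \<Omega>0_meas: "\<Omega> 0 \<in> sets lebesgue"
    using open_initial by simp
  let ?M = "lebesgue_on (\<Omega> 0)"
  let ?f = "\<lambda>s p. volume_factor s p * F s (\<phi> s p)"
  let ?f' = "\<lambda>s p. volume_factor s p * (F' s (\<phi> s p) + F s (\<phi> s p) * divergence (w s) (\<phi> s p))"
  let ?G = "\<lambda>p. exp (K * r) * (1 + K) * (volume_factor t p * g (\<phi> t p))"
  have volume_factor_nonneg: "volume_factor s p \<ge> 0" for s p
    by (simp add: volume_factor_def)
  have g_int: "integrable ?M (\<lambda>p. volume_factor t p * g (\<phi> t p))"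
    using flow_change_of_variables(1)[OF t] g by blast
  have f_meas: "?f s \<in> borel_measurable ?M" if "\<bar>s - t\<bar> < r" for s
  proof (rule continuous_imp_measurable_on_sets_lebesgue[OF _ \<Omega>0_meas])
    have s: "s > 0" using near[OF that] by simp
    have "continuous_on (\<Omega> 0) (\<lambda>p. (\<lambda>(s, p). d\<phi> s p h) (s, p))" for h
      using s by (intro continuous_on_compose2[OF d\<phi>_continuous] continuous_intros) auto
    then have "continuous_on (\<Omega> 0) (\<lambda>p. volume_factor s p)"
      unfolding volume_factor_def matrix_def det_def by (intro continuous_intros) simp
    moreover have "continuous_on (\<Omega> 0) (\<lambda>p. F s (\<phi> s p))"
      using s flow_in by (intro continuous_on_compose2[OF cont[OF s]]
          has_derivative_continuous_on[OF has_derivative_at_withinI[OF flow_deriv]]) auto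
    ultimately show "continuous_on (\<Omega> 0) (?f s)"
      by (intro continuous_intros)
  qed
  have f_deriv: "((\<lambda>s. ?f s p) has_real_derivative ?f' s p) (at s)"
    if "\<bar>s - t\<bar> < r" "p \<in> space ?M" for s p
    using F[OF near[OF that(1)]] volume_factor_ode[OF near(1)[OF that(1)]] that(2)
    by (auto intro!: derivative_eq_intros simp: algebra_simps)
  have f_int: "integrable ?M (?f t)"
    by (rule measurable_bounded_by_integrable_imp_lebesgue_integrable[OF f_meas g_int _ \<Omega>0_meas])
      (use t \<delta> r F_le[of t] volume_factor_nonneg in \<open>auto simp: abs_mult intro!: mult_left_mono\<close>)
  have G_int: "integrable ?M ?G"
    using g_int by (rule integrable_mult_right)
  have f'_le: "\<bar>?f' s p\<bar> \<le> ?G p" if s: "\<bar>s - t\<bar> < r" and "p \<in> space ?M" for s p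
  proof -
    have p: "p \<in> \<Omega> 0" using that(2) by simp
    note near = near[OF s]
    have K: "K \<ge> 0" using div_le[OF near p] by linarith
    have g0: "g (\<phi> t p) \<ge> 0" using F_le[OF near p] by linarith
    have "volume_factor s p \<le> volume_factor t p * exp (K * \<bar>s - t\<bar>)"
    proof (rule linear_ode_growth_bound[where \<delta> = r and a = "\<lambda>s. divergence (w s) (\<phi> s p)"])
      show "((\<lambda>s. volume_factor s p) has_real_derivative divergence (w s) (\<phi> s p) * volume_factor s p) (at s)"
        if "\<bar>s - t\<bar> < r" for s
        using that p by (intro volume_factor_ode) (auto simp: r_def)
      show "\<bar>divergence (w s) (\<phi> s p)\<bar> \<le> K" if "\<bar>s - t\<bar> < r" for s
        using that p by (intro div_le) (auto simp: r_def)
    qed (use s volume_factor_nonneg in auto)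
    also have "\<dots> \<le> volume_factor t p * exp (K * r)"
      using s K volume_factor_nonneg by (intro mult_left_mono) (auto intro: mult_left_mono)
    finally have vol_le: "volume_factor s p \<le> volume_factor t p * exp (K * r)" .
    have "\<bar>F' s (\<phi> s p) + F s (\<phi> s p) * divergence (w s) (\<phi> s p)\<bar>
        \<le> \<bar>F' s (\<phi> s p)\<bar> + \<bar>F s (\<phi> s p)\<bar> * \<bar>divergence (w s) (\<phi> s p)\<bar>"
      using abs_triangle_ineq by (metis abs_mult)
    also have "\<dots> \<le> g (\<phi> t p) + g (\<phi> t p) * K"
      using F'_le[OF near p] F_le[OF near p] div_le[OF near p] g0
      by (intro add_mono mult_mono) auto
    finally have "\<bar>?f' s p\<bar> \<le> volume_factor s p * (g (\<phi> t p) + g (\<phi> t p) * K)"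
      using volume_factor_nonneg[of s p] by (simp add: abs_mult mult_left_mono)
    also have "\<dots> \<le> (volume_factor t p * exp (K * r)) * (g (\<phi> t p) + g (\<phi> t p) * K)"
      using vol_le g0 K by (intro mult_right_mono) auto
    finally show ?thesis by (simp add: algebra_simps)
  qed
  note Leibniz = has_real_derivative_integral_dominated[where f = ?f and f' = ?f' and M = ?M and G = ?G,
      OF r f_deriv f_meas f_int G_int f'_le]
  note pullback = flow_change_of_variables[OF t, of "\<lambda>x. F' t x + F t x * divergence (w t) x"]
  have "((\<lambda>s. LINT p|?M. ?f s p) has_real_derivative
      (LINT x:\<Omega> t|lebesgue. F' t x + F t x * divergence (w t) x)) (at t)"
    unfolding pullback(2) by (rule Leibniz(1))
  then show "((\<lambda>s. LINT x:\<Omega> s|lebesgue. F s x) has_real_derivative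
      (LINT x:\<Omega> t|lebesgue. F' t x + F t x * divergence (w t) x)) (at t)"
    by (rule has_field_derivative_transform_within_open[where S = "{0<..}"])
      (use t flow_change_of_variables(2) in auto)
  show "(\<lambda>x. F' t x + F t x * divergence (w t) x) absolutely_integrable_on \<Omega> t"
    using pullback(1) Leibniz(2) by blast
qed

section \<open>The velocity as a test field and its kinetic energy\<close>

lemma velocity_bounds:
  assumes "t > 0"
  shows "\<exists>\<delta>>0. \<exists>M. \<exists>g::real^'n::_ \<Rightarrow> real. g \<in> L2 (\<Omega> t) \<and>
    (\<forall>s>0. \<bar>s - t\<bar> < \<delta> \<longrightarrow> (\<forall>p\<in>\<Omega> 0.
      norm (w s (\<phi> s p)) \<le> min M (g (\<phi> t p)) \<and>
      norm (jacobian (w s) (at (\<phi> s p))) \<le> min M (g (\<phi> t p)) \<and>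
      norm (material_derivative w w s (\<phi> s p)) \<le> g (\<phi> t p)))"
proof -
  have "t \<in> {0<..}" using assms by simp
  moreover have "(\<forall>s>0. P s) \<longleftrightarrow> (\<forall>s\<in>{0<..}. P s)" for P :: "real \<Rightarrow> bool"
    by auto
  ultimately show ?thesis
    using velocity unfolding regular_velocity_def interior_real_atLeast by simp
qed

text \<open>The square integrable majorant holds at the time \<open>t\<close> itself, and continuity on the open set \<open>\<Omega> t\<close>
  supplies the measurability.\<close>

lemma
  assumes t: "t > 0"
  shows velocity_L2: "w t \<in> L2 (\<Omega> t)"
    and gradient_L2: "(\<lambda>x. jacobian (w t) (at x)) \<in> L2 (\<Omega> t)"
    and velocity_weak_jacobian: "has_weak_jacobian (\<Omega> t) (w t) (\<lambda>x. jacobian (w t) (at x))"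
    and velocity_H1: "w t \<in> H1 (\<Omega> t)"
proof -
  obtain \<delta> M and g :: "real^'n::_ \<Rightarrow> real" where \<delta>: "\<delta> > 0" and g: "g \<in> L2 (\<Omega> t)"
    and "\<forall>s>0. \<bar>s - t\<bar> < \<delta> \<longrightarrow> (\<forall>p\<in>\<Omega> 0.
      norm (w s (\<phi> s p)) \<le> min M (g (\<phi> t p)) \<and>
      norm (jacobian (w s) (at (\<phi> s p))) \<le> min M (g (\<phi> t p)) \<and>
      norm (material_derivative w w s (\<phi> s p)) \<le> g (\<phi> t p))"
    using velocity_bounds[OF t] by blast
  note bounds = this(3)[rule_format]
  have bounds_t: "norm (w t x) \<le> g x" "norm (jacobian (w t) (at x)) \<le> g x" if "x \<in> \<Omega> t" for x
  proof -
    obtain p where "p \<in> \<Omega> 0" "x = \<phi> t p"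
      using \<open>x \<in> \<Omega> t\<close> \<Omega>_eq[of t] t by fastforce
    then show "norm (w t x) \<le> g x" "norm (jacobian (w t) (at x)) \<le> g x"
      using bounds[of t p] t \<delta> by auto
  qed
  have D: "open (\<Omega> t)" using open_\<Omega> t by simp
  show v: "w t \<in> L2 (\<Omega> t)"
    using bounds_t by (intro L2_of_continuous_dominated[OF D velocity_continuous[OF t] g])
  show G: "(\<lambda>x. jacobian (w t) (at x)) \<in> L2 (\<Omega> t)"
    using bounds_t by (intro L2_of_continuous_dominated[OF D jacobian_velocity_continuous_space[OF t] g])
  show J: "has_weak_jacobian (\<Omega> t) (w t) (\<lambda>x. jacobian (w t) (at x))"
    using velocity_space_deriv[OF t]
    by (intro classical_imp_weak_jacobian D jacobian_velocity_continuous_space[OF t]) (auto simp: differentiable_def)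
  show "w t \<in> H1 (\<Omega> t)"
    using v G J by (auto simp: H1_def)
qed

text \<open>The transport theorem for \<open>|w|\<^sup>2\<close>. The square integrable \<open>g\<close> bounds the velocity and its material
  derivative, so \<open>2 g\<^sup>2\<close> bounds \<open>|w|\<^sup>2\<close> and its material derivative \<open>2 Dw \<bullet> w\<close>; the uniform bound \<open>M\<close>
  on the gradient bounds the divergence.\<close>

lemma kinetic_energy_derivative:
  assumes t: "t > 0"
  shows "((\<lambda>s. (L2_norm (\<Omega> s) (w s))\<^sup>2) has_real_derivative
           2 * (LINT x:\<Omega> t|lebesgue.
             (material_derivative w w t x + (1/2) *\<^sub>R (divergence (w t) x *\<^sub>R w t x)) \<bullet> w t x)) (at t)"
proof -
  obtain \<delta> M and g :: "real^'n::_ \<Rightarrow> real" where \<delta>: "\<delta> > 0" and g: "g \<in> L2 (\<Omega> t)"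
    and "\<forall>s>0. \<bar>s - t\<bar> < \<delta> \<longrightarrow> (\<forall>p\<in>\<Omega> 0.
      norm (w s (\<phi> s p)) \<le> min M (g (\<phi> t p)) \<and>
      norm (jacobian (w s) (at (\<phi> s p))) \<le> min M (g (\<phi> t p)) \<and>
      norm (material_derivative w w s (\<phi> s p)) \<le> g (\<phi> t p))"
    using velocity_bounds[OF t] by blast
  note bounds = this(3)[rule_format]
  let ?F = "\<lambda>s x. (norm (w s x))\<^sup>2"
  let ?F' = "\<lambda>s x. 2 * (material_derivative w w s x \<bullet> w s x)"
  have "((\<lambda>s. LINT x:\<Omega> s|lebesgue. ?F s x) has_real_derivative
      (LINT x:\<Omega> t|lebesgue. ?F' t x + ?F t x * divergence (w t) x)) (at t)"
  proof (rule reynolds_transport(1)[OF t \<delta>, where g = "\<lambda>x. 2 * (norm (g x))\<^sup>2"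
        and K = "CARD('n) * M"])
    show "(\<lambda>x. 2 * (norm (g x))\<^sup>2) absolutely_integrable_on \<Omega> t"
      using g by (auto simp: L2_def)
    show "continuous_on (\<Omega> s) (?F s)" if "s > 0" for s
      by (intro continuous_intros velocity_continuous that)
  next
    fix s :: real and p
    assume s: "s > 0" "\<bar>s - t\<bar> < \<delta>" and p: "p \<in> \<Omega> 0"
    have w_le: "norm (w s (\<phi> s p)) \<le> g (\<phi> t p)" and
      w'_le: "norm (material_derivative w w s (\<phi> s p)) \<le> g (\<phi> t p)"
      using bounds[OF s p] by auto
    have g0: "g (\<phi> t p) \<ge> 0" using w_le norm_ge_zero order_trans by blast
    show "((\<lambda>s. ?F s (\<phi> s p)) has_real_derivative ?F' s (\<phi> s p)) (at s)"
    proof -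
      have "((\<lambda>s. w s (\<phi> s p) \<bullet> w s (\<phi> s p)) has_vector_derivative
          w s (\<phi> s p) \<bullet> material_derivative w w s (\<phi> s p)
          + material_derivative w w s (\<phi> s p) \<bullet> w s (\<phi> s p)) (at s)"
        by (rule bounded_bilinear.has_vector_derivative[OF bounded_bilinear_inner
            velocity_along_flow[OF s(1) p] velocity_along_flow[OF s(1) p]])
      then show ?thesis
        by (simp add: power2_norm_eq_inner has_real_derivative_iff_has_vector_derivative inner_commute)
    qed
    have "(norm (w s (\<phi> s p)))\<^sup>2 \<le> 2 * (g (\<phi> t p))\<^sup>2"
      using power_mono[OF w_le norm_ge_zero, of 2] zero_le_power2[of "g (\<phi> t p)"] by linarith
    then show "\<bar>?F s (\<phi> s p)\<bar> \<le> 2 * (norm (g (\<phi> t p)))\<^sup>2"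
      by simp
    have "\<bar>material_derivative w w s (\<phi> s p) \<bullet> w s (\<phi> s p)\<bar> \<le> g (\<phi> t p) * g (\<phi> t p)"
      by (rule order_trans[OF Cauchy_Schwarz_ineq2]) (intro mult_mono w_le w'_le g0 norm_ge_zero)
    then show "\<bar>?F' s (\<phi> s p)\<bar> \<le> 2 * (norm (g (\<phi> t p)))\<^sup>2"
      by (simp add: abs_mult power2_eq_square)
    have "\<bar>divergence (w s) (\<phi> s p)\<bar> \<le> CARD('n) * norm (jacobian (w s) (at (\<phi> s p)))"
      unfolding divergence_def by (rule trace_le_norm)
    also have "\<dots> \<le> CARD('n) * M"
      using bounds[OF s p] by (intro mult_left_mono) auto
    finally show "\<bar>divergence (w s) (\<phi> s p)\<bar> \<le> CARD('n) * M" .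
  qed
  moreover have "(L2_norm (\<Omega> s) (w s))\<^sup>2 = (LINT x:\<Omega> s|lebesgue. ?F s x)" for s
    by (simp add: L2_norm_def set_lebesgue_integral_def)
  moreover have "(LINT x:\<Omega> t|lebesgue. ?F' t x + ?F t x * divergence (w t) x)
      = 2 * (LINT x:\<Omega> t|lebesgue.
          (material_derivative w w t x + (1/2) *\<^sub>R (divergence (w t) x *\<^sub>R w t x)) \<bullet> w t x)"
    unfolding set_integral_mult_right[symmetric]
    by (simp add: algebra_simps inner_add_left power2_norm_eq_inner)
  ultimately show ?thesis by simp
qed

section \<open>The rate of change of the shape functional\<close>

text \<open>The motion seen from the domain \<open>\<Omega> t\<close>, with time counted from \<open>t\<close>. Its flow map takes a point of
  \<open>\<Omega> t\<close> back to its initial position and then on to time \<open>t + s\<close>; it exists for negative \<open>s\<close> as well, down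
  to \<open>-t\<close>, and this makes the derivative at time \<open>t\<close> two-sided.\<close>

lemma restarted_motion:
  assumes t: "t > 0"
  obtains \<Phi> where "driven_by {-t<..<t} (\<lambda>s. \<Omega> (t + s)) (\<lambda>s. w (t + s)) \<Phi>"
    and "regular_velocity {-t<..<t} (\<lambda>s. \<Omega> (t + s)) (\<lambda>s. w (t + s)) \<Phi>"
proof -
  obtain g where g: "homeomorphism (closure (\<Omega> 0)) (closure (\<Omega> t)) (\<phi> t) g"
    using flow_homeomorphism[of t] t by auto
  define \<Phi> where "\<Phi> s x = \<phi> (t + s) (g x)" for s x
  have \<Phi>_flow: "\<Phi> s (\<phi> t p) = \<phi> (t + s) p" if "p \<in> closure (\<Omega> 0)" for s p
    using homeomorphism_apply1[OF g that] by (simp add: \<Phi>_def)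
  have sub: "\<Omega> 0 \<subseteq> closure (\<Omega> 0)" "frontier (\<Omega> 0) \<subseteq> closure (\<Omega> 0)"
    by (auto simp: frontier_def closure_subset)
  have image: "\<Phi> s ` \<phi> t ` A = \<phi> (t + s) ` A" if "A \<subseteq> closure (\<Omega> 0)" for s A
    using \<Phi>_flow that by (auto simp: image_image subset_iff image_iff)
  have \<Omega>t: "\<Omega> t = \<phi> t ` \<Omega> 0"
    using \<Omega>_eq[of t] t by simp
  have "driven_by {-t<..<t} (\<lambda>s. \<Omega> (t + s)) (\<lambda>s. w (t + s)) \<Phi>"
    unfolding driven_by_def add_0_right
  proof (intro conjI ballI)
    show "open (\<Omega> t)" using open_\<Omega> t by simp
    have "connected (\<Omega> 0)" "\<Omega> 0 \<noteq> {}"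
      using motion unfolding driven_by_def by blast+
    moreover have "continuous_on (\<Omega> 0) (\<phi> t)"
      using homeomorphism_cont1[OF g] sub(1) by (rule continuous_on_subset)
    ultimately show "connected (\<Omega> t)" "\<Omega> t \<noteq> {}"
      unfolding \<Omega>t by (auto intro: connected_continuous_image)
    show "\<Phi> 0 p = p" if "p \<in> closure (\<Omega> t)" for p
      using homeomorphism_apply2[OF g that] by (simp add: \<Phi>_def)
  next
    fix s p assume s: "s \<in> {-t<..<t}" and p: "p \<in> closure (\<Omega> t)"
    have q: "g p \<in> closure (\<Omega> 0)"
      using homeomorphism_image2[OF g] p by blast
    have ts: "t + s \<in> {0..}" "t + s \<in> interior {0..}"
      using s by auto
    have "((\<lambda>s. \<phi> s (g p)) has_vector_derivative w (t + s) (\<phi> (t + s) (g p))) (at (t + s) within {0..})"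
      using motion q ts(1) unfolding driven_by_def by blast
    then have "((\<lambda>s. \<phi> s (g p)) has_vector_derivative w (t + s) (\<phi> (t + s) (g p))) (at (t + s))"
      using at_within_interior[OF ts(2)] by simp
    then have "((\<lambda>s. \<Phi> s p) has_vector_derivative w (t + s) (\<Phi> s p)) (at s)"
      unfolding \<Phi>_def by (rule has_vector_derivative_shift)
    then show "((\<lambda>s. \<Phi> s p) has_vector_derivative w (t + s) (\<Phi> s p)) (at s within {-t<..<t})"
      by (rule has_vector_derivative_at_within)
  next
    fix s assume s: "s \<in> {-t<..<t}"
    then have ts: "t + s \<ge> 0" by simp
    show "\<Omega> (t + s) = \<Phi> s ` \<Omega> t"
      unfolding \<Omega>t image[OF sub(1)] by (rule \<Omega>_eq[OF ts])
    show "frontier (\<Omega> (t + s)) = \<Phi> s ` frontier (\<Omega> t)"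
      using frontier_eq[OF ts] frontier_eq[OF less_imp_le[OF t]] image[OF sub(2)] by simp
    obtain g' where "homeomorphism (closure (\<Omega> 0)) (closure (\<Omega> (t + s))) (\<phi> (t + s)) g'"
      using flow_homeomorphism[OF ts] .
    from homeomorphism_compose[OF homeomorphism_symD[OF g] this]
    show "\<exists>h. homeomorphism (closure (\<Omega> t)) (closure (\<Omega> (t + s))) (\<Phi> s) h"
      by (auto simp: o_def \<Phi>_def[abs_def])
  qed
  moreover have "regular_velocity {-t<..<t} (\<lambda>s. \<Omega> (t + s)) (\<lambda>s. w (t + s)) \<Phi>"
    unfolding regular_velocity_def interior_open[OF open_greaterThanLessThan] add_0_right
  proof (intro conjI ballI)
    have shift: "(\<lambda>z. (\<lambda>(s, x). w s x) ((t, 0) + z)) = (\<lambda>(s, x). w (t + s) x)"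
      by (auto simp: fun_eq_iff)
    have "C_k_on 1 {(s, x). s \<in> {-t<..<t} \<and> x \<in> \<Omega> (t + s)} (\<lambda>z. (\<lambda>(s, x). w s x) ((t, 0) + z))"
      by (rule C1_on_translate[OF velocity_C1]) auto
    then show "C_k_on 1 {(s, x). s \<in> {-t<..<t} \<and> x \<in> \<Omega> (t + s)} (\<lambda>(s, x). w (t + s) x)"
      by (simp only: shift)
    have "continuous_on {(s, x). s \<in> {0..} \<and> x \<in> closure (\<Omega> s)} (\<lambda>(s, x). w s x)"
      using velocity unfolding regular_velocity_def by blast
    then have "continuous_on {(s, x). s \<in> {-t<..<t} \<and> x \<in> closure (\<Omega> (t + s))}
        (\<lambda>z. (\<lambda>(s, x). w s x) ((t, 0) + z))"
      by (rule continuous_on_compose2) (auto intro!: continuous_intros)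
    then show "continuous_on {(s, x). s \<in> {-t<..<t} \<and> x \<in> closure (\<Omega> (t + s))} (\<lambda>(s, x). w (t + s) x)"
      by (simp only: shift)
    show "w (t + s) \<in> W1inf (\<Omega> (t + s))" if "s \<in> {-t<..<t}" for s
    proof -
      have "t + s \<in> {0..}" using that by simp
      then show ?thesis using velocity unfolding regular_velocity_def by blast
    qed
  next
    fix s assume "s \<in> {-t<..<t}"
    then have ts: "t + s > 0" by simp
    obtain \<delta> M and G :: "real^'n::_ \<Rightarrow> real" where \<delta>: "\<delta> > 0" and G: "G \<in> L2 (\<Omega> (t + s))"
      and "\<forall>r>0. \<bar>r - (t + s)\<bar> < \<delta> \<longrightarrow> (\<forall>p\<in>\<Omega> 0.
        norm (w r (\<phi> r p)) \<le> min M (G (\<phi> (t + s) p)) \<and>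
        norm (jacobian (w r) (at (\<phi> r p))) \<le> min M (G (\<phi> (t + s) p)) \<and>
        norm (material_derivative w w r (\<phi> r p)) \<le> G (\<phi> (t + s) p))"
      using velocity_bounds[OF ts] by blast
    note bounds = this(3)[rule_format]
    have material: "material_derivative (\<lambda>s. w (t + s)) (\<lambda>s. w (t + s)) r x = material_derivative w w (t + r) x"
      if "t + r > 0" "x \<in> \<Omega> (t + r)" for r x
      using velocity_time_deriv[OF that] has_vector_derivative_shift[OF velocity_time_deriv[OF that]]
      by (simp add: material_derivative_def vector_derivative_at)
    show "\<exists>\<delta>>0. \<exists>M. \<exists>g::real^'n::_ \<Rightarrow> real. g \<in> L2 (\<Omega> (t + s)) \<and>
        (\<forall>r\<in>{-t<..<t}. \<bar>r - s\<bar> < \<delta> \<longrightarrow> (\<forall>p\<in>\<Omega> t.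
           norm (w (t + r) (\<Phi> r p)) \<le> min M (g (\<Phi> s p)) \<and>
           norm (jacobian (w (t + r)) (at (\<Phi> r p))) \<le> min M (g (\<Phi> s p)) \<and>
           norm (material_derivative (\<lambda>s. w (t + s)) (\<lambda>s. w (t + s)) r (\<Phi> r p)) \<le> g (\<Phi> s p)))"
    proof (rule exI[of _ \<delta>], intro conjI \<delta> exI[of _ M] exI[of _ G] G ballI impI)
      fix r p assume "r \<in> {-t<..<t}" "\<bar>r - s\<bar> < \<delta>" and p: "p \<in> \<Omega> t"
      then have r: "t + r > 0" "\<bar>(t + r) - (t + s)\<bar> < \<delta>" by auto
      obtain q where q: "q \<in> \<Omega> 0" "p = \<phi> t q"
        using p unfolding \<Omega>t by blast
      have \<Phi>p: "\<Phi> r' p = \<phi> (t + r') q" for r'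
        using \<Phi>_flow q sub by blast
      have "\<phi> (t + r) q \<in> \<Omega> (t + r)"
        using flow_in[of "t + r" q] r q by simp
      then show "norm (w (t + r) (\<Phi> r p)) \<le> min M (G (\<Phi> s p))"
        "norm (jacobian (w (t + r)) (at (\<Phi> r p))) \<le> min M (G (\<Phi> s p))"
        "norm (material_derivative (\<lambda>s. w (t + s)) (\<lambda>s. w (t + s)) r (\<Phi> r p)) \<le> G (\<Phi> s p)"
        unfolding \<Phi>p using bounds[OF r q(1)] by (simp_all add: material[OF r(1)])
    qed
  qed
  ultimately show thesis using that by blast
qed

text \<open>The Eulerian derivative speaks of motions that start at time 0; it is applied to the restarted one
  and the result is shifted back in time.\<close>

lemma shape_functional_derivative:
  assumes t: "t > 0" and L: "has_eulerian_derivative J (\<Omega> t) L"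
  shows "((\<lambda>s. J (\<Omega> s)) has_real_derivative L (w t)) (at t)"
proof -
  obtain \<Phi> where "driven_by {-t<..<t} (\<lambda>s. \<Omega> (t + s)) (\<lambda>s. w (t + s)) \<Phi>"
    and "regular_velocity {-t<..<t} (\<lambda>s. \<Omega> (t + s)) (\<lambda>s. w (t + s)) \<Phi>"
    using restarted_motion[OF t] .
  moreover have "\<forall>v\<in>H1 (\<Omega> t). \<forall>\<delta>>0. \<forall>E V \<Phi>.
      E 0 = \<Omega> t \<and> driven_by {-\<delta><..<\<delta>} E V \<Phi> \<and> regular_velocity {-\<delta><..<\<delta>} E V \<Phi> \<and>
      (\<forall>x\<in>\<Omega> t. V 0 x = v x) \<longrightarrow> ((\<lambda>s. J (E s)) has_real_derivative L v) (at 0)"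
    using L unfolding has_eulerian_derivative_def by blast
  from this[rule_format, OF velocity_H1[OF t] t, of "\<lambda>s. \<Omega> (t + s)" "\<lambda>s. w (t + s)" \<Phi>]
  have "driven_by {-t<..<t} (\<lambda>s. \<Omega> (t + s)) (\<lambda>s. w (t + s)) \<Phi> \<Longrightarrow>
      regular_velocity {-t<..<t} (\<lambda>s. \<Omega> (t + s)) (\<lambda>s. w (t + s)) \<Phi> \<Longrightarrow>
      ((\<lambda>s. J (\<Omega> (t + s))) has_real_derivative L (w t)) (at 0)"
    by simp
  ultimately have "((\<lambda>s. J (\<Omega> (t + s))) has_real_derivative L (w t)) (at 0)"
    by blast
  then show ?thesis
    using DERIV_shift[of "\<lambda>s. J (\<Omega> s)" "L (w t)" 0 t] by (simp add: add.commute)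
qed

end

section \<open>Dissipation of the mechanical energy\<close>

theorem lemma3p2:
  fixes \<Omega> :: "real \<Rightarrow> (real^'n::{finite,wellorder}) set"
    and w \<phi> :: "real \<Rightarrow> real^'n::_ \<Rightarrow> real^'n::_"
    and \<epsilon>0 c t0 :: real
    and \<eta> :: "real \<Rightarrow> real"
    and PDE :: "(real^'n::_) set \<Rightarrow> (real^'n::_ \<Rightarrow> 'b::euclidean_space) \<Rightarrow> bool"
    and u :: "(real^'n::_) set \<Rightarrow> real^'n::_ \<Rightarrow> 'b"
    and j :: "real^'n::_ \<Rightarrow> 'b \<Rightarrow> real"
    and J :: "(real^'n::_) set \<Rightarrow> real"
    and dJ :: "(real^'n::_) set \<Rightarrow> (real^'n::_ \<Rightarrow> real^'n::_) \<Rightarrow> real"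
  assumes dim: "CARD('n) = 2 \<or> CARD('n) = 3"
    and pos: "\<epsilon>0 > 0" "c > 0" "t0 > 0"
    and eta: "\<And>t. \<eta> t = c / (t + t0)"
    and state: "solution_map PDE u" "\<And>t. t \<ge> 0 \<Longrightarrow> \<exists>v. PDE (\<Omega> t) v"
    and J: "J = shape_functional j u"
    and J_finite: "\<And>t. t \<ge> 0 \<Longrightarrow> (\<lambda>x. j x (u (\<Omega> t) x)) absolutely_integrable_on \<Omega> t"
    and dJ: "\<And>t. t > 0 \<Longrightarrow> has_eulerian_derivative J (\<Omega> t) (dJ (\<Omega> t))"
    and motion: "driven_by {0..} \<Omega> w \<phi>"
    and smooth_motion: "C_k_on 2 ({0<..} \<times> \<Omega> 0) (\<lambda>(t, p). \<phi> t p)"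
    and velocity: "regular_velocity {0..} \<Omega> w \<phi>"
    and flow: "inertial_gradient_flow \<epsilon>0 \<eta> dJ \<Omega> w"
  shows "\<forall>t>0.
      mechanical_energy \<epsilon>0 J \<Omega> w t
        = (LINT x:\<Omega> t|lebesgue. j x (u (\<Omega> t) x) + \<epsilon>0 / 2 * (norm (w t x))\<^sup>2) \<and>
      (mechanical_energy \<epsilon>0 J \<Omega> w has_real_derivative
         - \<eta> t * ((L2_norm (\<Omega> t) (w t))\<^sup>2 + (L2_norm (\<Omega> t) (\<lambda>x. jacobian (w t) (at x)))\<^sup>2)) (at t) \<and>
      - \<eta> t * ((L2_norm (\<Omega> t) (w t))\<^sup>2 + (L2_norm (\<Omega> t) (\<lambda>x. jacobian (w t) (at x)))\<^sup>2) \<le> 0"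
proof (intro allI impI conjI)
  interpret regular_motion \<Omega> w \<phi>
    using motion C2_imp_C1[OF smooth_motion] velocity by unfold_locales
  fix t :: real assume t: "t > 0"
  have L2_norm_sq: "(L2_norm D f)\<^sup>2 = (LINT x:D|lebesgue. (norm (f x))\<^sup>2)"
    for D and f :: "real^'n::_ \<Rightarrow> 'c::euclidean_space"
    by (simp add: L2_norm_def set_lebesgue_integral_def)
  have w_int: "(\<lambda>x. (norm (w t x))\<^sup>2) absolutely_integrable_on \<Omega> t"
    and grad_int: "(\<lambda>x. (norm (jacobian (w t) (at x)))\<^sup>2) absolutely_integrable_on \<Omega> t"
    using velocity_L2[OF t] gradient_L2[OF t] by (auto simp: L2_def)
  show "mechanical_energy \<epsilon>0 J \<Omega> w t
      = (LINT x:\<Omega> t|lebesgue. j x (u (\<Omega> t) x) + \<epsilon>0 / 2 * (norm (w t x))\<^sup>2)"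
    using set_integral_add(2)[OF J_finite[OF less_imp_le[OF t]] set_integrable_mult_right[OF w_int, of "\<epsilon>0 / 2"]]
    by (simp add: mechanical_energy_def J shape_functional_def L2_norm_sq)
  let ?K = "LINT x:\<Omega> t|lebesgue.
    (material_derivative w w t x + (1/2) *\<^sub>R (divergence (w t) x *\<^sub>R w t x)) \<bullet> w t x"
  let ?E = "(L2_norm (\<Omega> t) (w t))\<^sup>2 + (L2_norm (\<Omega> t) (\<lambda>x. jacobian (w t) (at x)))\<^sup>2"
  have "\<epsilon>0 * ?K + \<eta> t * (LINT x:\<Omega> t|lebesgue. w t x \<bullet> w t x + jacobian (w t) (at x) \<bullet> jacobian (w t) (at x))
      = - dJ (\<Omega> t) (w t)"
    using flow t velocity_H1[OF t] velocity_weak_jacobian[OF t]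
    unfolding inertial_gradient_flow_def by blast
  moreover have "(LINT x:\<Omega> t|lebesgue. w t x \<bullet> w t x + jacobian (w t) (at x) \<bullet> jacobian (w t) (at x)) = ?E"
    using set_integral_add(2)[OF w_int grad_int] by (simp add: L2_norm_sq power2_norm_eq_inner)
  ultimately have tested: "dJ (\<Omega> t) (w t) + \<epsilon>0 * ?K = - \<eta> t * ?E"
    by simp
  have "((\<lambda>s. J (\<Omega> s) + \<epsilon>0 / 2 * (L2_norm (\<Omega> s) (w s))\<^sup>2) has_real_derivative
      dJ (\<Omega> t) (w t) + \<epsilon>0 / 2 * (2 * ?K)) (at t)"
    by (intro DERIV_add DERIV_cmult shape_functional_derivative[OF t dJ[OF t]] kinetic_energy_derivative[OF t])
  then show "(mechanical_energy \<epsilon>0 J \<Omega> w has_real_derivative - \<eta> t * ?E) (at t)"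
    using tested by (simp add: mechanical_energy_def[abs_def])
  have "\<eta> t \<ge> 0"
    using eta pos t by simp
  then show "- \<eta> t * ?E \<le> 0"
    by simp
qed

end
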